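(* Let $U\subset\mathbb{R}^2$ be a sufficiently small domain divided by a non-singular real analytic curve $\Gamma\subset U$ into two parts $U_1$ and $U_2$. Let $P=(x_0,y_0)$ be a point in $U_1$ having its reflected point $Q=R(x_0,y_0)$ in $U_2$. Then any biharmonic function $u(x,y)$ in the domain $U$ subject to one of the conditions (i)--(v) below on the curve $\Gamma$ can be continued across $\Gamma$, using the following reflection formulas: (i) if $u=\partial_n u=0$ on $\Gamma$, then $$\begin{aligned}u(P)=&-u(Q)-\Bigl(x_0-\frac{S(x_0+iy_0)+\widetilde S(x_0-iy_0)}{2}\Bigr)\frac{\partial u}{\partial x}(Q)\\&-\Bigl(y_0+\frac{S(x_0+iy_0)-\widetilde S(x_0-iy_0)}{2i}\Bigr)\frac{\partial u}{\partial y}(Q)\\&-\frac14\Bigl(x_0^2+y_0^2-S(x_0+iy_0)(x_0+iy_0)-\widetilde S(x_0-iy_0)(x_0-iy_0)\\&\qquad+S(x_0+iy_0)\widetilde S(x_0-iy_0)\Bigr)\Delta u(Q);\end{aligned}$$ (ii) if $u=\Delta u=0$ on $\Gamma$, then $$u(P)=-u(Q)+\hat{\mathbb{K}}_2;$$ (iii) if $u=\partial_n\Delta u=0$ on $\Gamma$, then $$u(P)=-u(Q)+\hat{\mathbb{K}}_3;$$ (iv) if $\partial_n u=\Delta u=0$ on $\Gamma$, then $$u(P)=u(Q)+\hat{\mathbb{K}}_4;$$ (v) if $\partial_n u=\partial_n\Delta u=0$ on $\Gamma$, then $$u(P)=u(Q)+\hat{\mathbb{K}}_5;$$ where, for $j=2,3,4,5$,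 $$\begin{aligned}\hat{\mathbb{K}}_j=\frac{1}{8i}\int_{\Gamma}^{Q}&\Bigl(V^{(j)}\frac{\partial\Delta u}{\partial y}-\Delta u\,\frac{\partial V^{(j)}}{\partial y}+\Delta V^{(j)}\,\frac{\partial u}{\partial y}-u\,\frac{\partial\Delta V^{(j)}}{\partial y}\Bigr)dx\\-&\Bigl(V^{(j)}\frac{\partial\Delta u}{\partial x}-\Delta u\,\frac{\partial V^{(j)}}{\partial x}+\Delta V^{(j)}\,\frac{\partial u}{\partial x}-u\,\frac{\partial\Delta V^{(j)}}{\partial x}\Bigr)dy,\end{aligned}$$ the integral is computed along an arbitrary path joining the curve $\Gamma$ with the reflected point $Q$, and $V^{(j)}=V^{(j)}_1-V^{(j)}_2$ (the functions $V_1^{(j)},V_2^{(j)}$ being the explicit series given in the context).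
   Context: $\Delta=\partial^2/\partial x^2+\partial^2/\partial y^2$. A function $u(x,y)$ of class $C^4$ on a domain is called biharmonic there if $\Delta^2u=0$. $\partial_n$ denotes the normal derivative on $\Gamma$. Schwarz function and reflection. Let $\Gamma=\{f(x,y)=0\}$ be a non-singular real analytic curve ($\operatorname{grad} f\neq0$ on $\Gamma$). With $z=x+iy$, $w=x-iy$ regarded as independent complex variables, the complexified curve $\Gamma_{\mathbb C}$ has equation $f\bigl(\frac{z+w}{2},\frac{z-w}{2i}\bigr)=0$, which near $\Gamma$ can be solved as $w=S(z)$, or equivalently $z=\widetilde S(w)$. Here $S$ is the Schwarz function of $\Gamma$ (analytic near $\Gamma$, with $S(z)=\bar z$ on $\Gamma$) and $\widetilde S$ is its inverse. The anti-conformal reflection is $R(x_0,y_0)=R(z_0)=\overline{S(z_0)}$, with $\mathbb{R}^2$ identified with $\mathbb{C}$; it is defined near $\Gamma$, fixes $\Gamma$ pointwise and interchanges the two sides of $\Gamma$. The functions $V_1^{(j)},V_2^{(j)}$. Put $z_0=x_0+iy_0$, $w_0=x_0-iy_0$. For $j=2,3,4,5$ define $$V_1^{(j)}=\sum_{k=1}^{\infty}b_k^{(j)}(z,w,w_0)\frac{(\widetilde S(w)-z_0)^k}{k!},\qquad V_2^{(j)}=\sum_{k=1}^{\infty}a_k^{(j)}(z,w,z_0)\frac{(S(z)-w_0)^k}{k!},$$ regarded as functions of $(x,y)$ through $z=x+iy$, $w=x-iy$ (and depending on the parameters $x_0,y_0$). Write $S'=S'(z)$, $\widetilde S'=\widetilde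 S'(w)$, and define functions $\hat D_z^{m}$ of $z$ and $\hat D_w^m$ of $w$ by $$\hat D_z^0=1,\quad \hat D_z^{m}=\frac{\partial}{\partial z}\Bigl(\frac{1}{S'}\hat D_z^{m-1}\Bigr),\qquad \hat D_w^0=1,\quad \hat D_w^{m}=\frac{\partial}{\partial w}\Bigl(\frac{1}{\widetilde S'}\hat D_w^{m-1}\Bigr),\quad m\ge1,$$ so e.g. $\hat D^1_z=\frac{\partial}{\partial z}\bigl(\frac1{S'}\bigr)$ and $\hat D_z^2=\frac{\partial}{\partial z}\bigl(\frac1{S'}\frac{\partial}{\partial z}\bigl(\frac1{S'}\bigr)\bigr)$. The coefficients are as follows, with $k\ge2$ in the general formulas. $j=2$: $$a_1^{(2)}=z-z_0+\frac{w-S(z)}{S'},\quad a_k^{(2)}=(-1)^{k-1}\frac{w-S(z)}{S'}\hat D_z^{k-1},$$ $$b_1^{(2)}=w-w_0+\frac{z-\widetilde S(w)}{\widetilde S'},\quad b_k^{(2)}=(-1)^{k-1}\frac{z-\widetilde S(w)}{\widetilde S'}\hat D_w^{k-1}.$$ $j=3$: $$a_1^{(3)}=-(z-z_0)+\frac{w-S(z)}{S'},\quad a_k^{(3)}=(-1)^k\Bigl(\frac{2k}{S'}\hat D_z^{k-2}-\frac{w-S(z)}{S'}\hat D_z^{k-1}\Bigr),$$ $$b_1^{(3)}=-(w-w_0)+\frac{z-\widetilde S(w)}{\widetilde S'},\quad b_k^{(3)}=(-1)^k\Bigl(\frac{2k}{\widetilde S'}\hat D_w^{k-2}-\frac{z-\widetilde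 S(w)}{\widetilde S'}\hat D_w^{k-1}\Bigr).$$ $j=4$: $$a_1^{(4)}=z-z_0-\frac{w-S(z)}{S'},\quad a_k^{(4)}=(-1)^k\frac{w-S(z)}{S'}\hat D_z^{k-1},$$ $$b_1^{(4)}=w-w_0-\frac{z-\widetilde S(w)}{\widetilde S'},\quad b_k^{(4)}=(-1)^k\frac{z-\widetilde S(w)}{\widetilde S'}\hat D_w^{k-1}.$$ $j=5$: $$a_1^{(5)}=-(z-z_0)-\frac{w-S(z)}{S'},\quad a_k^{(5)}=(-1)^{k-1}\Bigl(\frac{2k-4}{S'}\hat D_z^{k-2}-\frac{w-S(z)}{S'}\hat D_z^{k-1}\Bigr),$$ $$b_1^{(5)}=-(w-w_0)-\frac{z-\widetilde S(w)}{\widetilde S'},\quad b_k^{(5)}=(-1)^{k-1}\Bigl(\frac{2k-4}{\widetilde S'}\hat D_w^{k-2}-\frac{z-\widetilde S(w)}{\widetilde S'}\hat D_w^{k-1}\Bigr).$$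
   Formalization: "Sufficiently small" is read as: U lies in a small disc about a point of Γ, U is simply connected, U∩R(U) and Γ are connected, as for all small discs; for arbitrarily shaped small domains the formulas can fail. *)

theory Defs
  imports "HOL-Analysis.Analysis"
begin

text \<open>The plane is identified with the complex numbers, \<open>(x, y)\<close> being \<open>x + \<i> y\<close>.\<close>

section \<open>Differential operators on the plane\<close>

definition dx :: "(complex \<Rightarrow> 'a::real_normed_vector) \<Rightarrow> complex \<Rightarrow> 'a"
  where "dx g z = vector_derivative (\<lambda>t. g (z + of_real t)) (at 0)"

definition dy :: "(complex \<Rightarrow> 'a::real_normed_vector) \<Rightarrow> complex \<Rightarrow> 'a"
  where "dy g z = vector_derivative (\<lambda>t. g (z + \<i> * of_real t)) (at 0)"

definition laplacian :: "(complex \<Rightarrow> 'a::real_normed_vector) \<Rightarrow> complex \<Rightarrow> 'a"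
  where "laplacian g z = dx (dx g) z + dy (dy g) z"

primrec Ck_on :: "nat \<Rightarrow> (complex \<Rightarrow> 'a::real_normed_vector) \<Rightarrow> complex set \<Rightarrow> bool"
  where
    "Ck_on 0 g U \<longleftrightarrow> continuous_on U g"
  | "Ck_on (Suc k) g U \<longleftrightarrow>
       (\<forall>z\<in>U. g differentiable (at z)) \<and> Ck_on k (dx g) U \<and> Ck_on k (dy g) U"

definition biharmonic_on :: "(complex \<Rightarrow> real) \<Rightarrow> complex set \<Rightarrow> bool"
  where "biharmonic_on u U \<longleftrightarrow> Ck_on 4 u U \<and> (\<forall>z\<in>U. laplacian (laplacian u) z = 0)"

text \<open>Derivative along the unit normal \<open>grad f / |grad f|\<close> of the level curve of \<open>f\<close>
  through \<open>z\<close>. The choice of the orientation is immaterial, as only the vanishing of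
  normal derivatives is used.\<close>

definition normal_deriv :: "(complex \<Rightarrow> real) \<Rightarrow> (complex \<Rightarrow> real) \<Rightarrow> complex \<Rightarrow> real"
  where "normal_deriv f g z =
    (dx f z * dx g z + dy f z * dy g z) / sqrt ((dx f z)\<^sup>2 + (dy f z)\<^sup>2)"

section \<open>Real analytic curves and the Schwarz function\<close>

definition has_xy_expansion ::
  "(complex \<Rightarrow> real) \<Rightarrow> (nat \<Rightarrow> nat \<Rightarrow> real) \<Rightarrow> complex \<Rightarrow> real \<Rightarrow> bool"
  where "has_xy_expansion f c p r \<longleftrightarrow>
    (\<forall>z. \<bar>Re z - Re p\<bar> < r \<and> \<bar>Im z - Im p\<bar> < r \<longrightarrow>
      ((\<lambda>(m, n). c m n * (Re z - Re p) ^ m * (Im z - Im p) ^ n) has_sum f z) UNIV)"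

definition real_analytic_on :: "(complex \<Rightarrow> real) \<Rightarrow> complex set \<Rightarrow> bool"
  where "real_analytic_on f A \<longleftrightarrow> (\<forall>p\<in>A. \<exists>c. \<exists>r>0. has_xy_expansion f c p r)"

text \<open>\<open>S\<close> is (a representative of the germ at \<open>p\<close> of) the Schwarz function of the curve
  \<open>f = 0\<close>: substituting the complex values \<open>(z + w) / 2\<close> and \<open>(z - w) / (2 \<i>)\<close> for \<open>x\<close> and \<open>y\<close>
  in the power series of \<open>f\<close> at \<open>p\<close> gives the complexified curve, which is solved by \<open>w = S z\<close>.\<close>

definition schwarz_function_at ::
  "(complex \<Rightarrow> real) \<Rightarrow> complex \<Rightarrow> (complex \<Rightarrow> complex) \<Rightarrow> bool"
  where "schwarz_function_at f p S \<longleftrightarrow>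
    (\<exists>c. \<exists>r>0. has_xy_expansion f c p r \<and> S holomorphic_on ball p r \<and>
      (\<forall>z\<in>ball p r. f z = 0 \<longrightarrow> S z = cnj z) \<and>
      (\<forall>z\<in>ball p r.
        ((\<lambda>(m, n). of_real (c m n) * ((z + S z) / 2 - of_real (Re p)) ^ m
                   * ((z - S z) / (2 * \<i>) - of_real (Im p)) ^ n) has_sum 0) UNIV))"

text \<open>\<open>St\<close> is the local inverse of \<open>S\<close>, near the point \<open>S p = cnj p\<close>.\<close>

definition schwarz_inverse_at ::
  "complex \<Rightarrow> (complex \<Rightarrow> complex) \<Rightarrow> (complex \<Rightarrow> complex) \<Rightarrow> bool"
  where "schwarz_inverse_at p S St \<longleftrightarrow>
    (\<exists>r>0. St holomorphic_on ball (cnj p) r \<and>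
      (\<forall>z\<in>ball p r. St (S z) = z) \<and> (\<forall>w\<in>ball (cnj p) r. S (St w) = w))"

definition reflection :: "(complex \<Rightarrow> complex) \<Rightarrow> complex \<Rightarrow> complex"
  where "reflection S z = cnj (S z)"

section \<open>The functions \<open>V\<^sup>(\<^sup>j\<^sup>)\<close>\<close>

primrec Dhat :: "(complex \<Rightarrow> complex) \<Rightarrow> nat \<Rightarrow> complex \<Rightarrow> complex"
  where
    "Dhat T 0 = (\<lambda>s. 1)"
  | "Dhat T (Suc m) = deriv (\<lambda>s. 1 / deriv T s * Dhat T m s)"

text \<open>The formulas for \<open>b\<^sub>k\<close> arise from those for \<open>a\<^sub>k\<close> by exchanging \<open>z, w, z\<^sub>0, S\<close> with
  \<open>w, z, w\<^sub>0, St\<close>. Thus \<open>a\<^sub>k(z, w, z\<^sub>0)\<close> is \<open>cf S k z w z\<^sub>0\<close> and \<open>b\<^sub>k(z, w, w\<^sub>0)\<close> is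
  \<open>cf St k w z w\<^sub>0\<close>, for each of the following four functions \<open>cf\<close>. Only \<open>k \<ge> 1\<close> is used.\<close>

definition coeff2 ::
  "(complex \<Rightarrow> complex) \<Rightarrow> nat \<Rightarrow> complex \<Rightarrow> complex \<Rightarrow> complex \<Rightarrow> complex"
  where "coeff2 T k s t s0 =
    (if k = 1 then s - s0 + (t - T s) / deriv T s
     else (-1) ^ (k - 1) * ((t - T s) / deriv T s) * Dhat T (k - 1) s)"

definition coeff3 ::
  "(complex \<Rightarrow> complex) \<Rightarrow> nat \<Rightarrow> complex \<Rightarrow> complex \<Rightarrow> complex \<Rightarrow> complex"
  where "coeff3 T k s t s0 =
    (if k = 1 then - (s - s0) + (t - T s) / deriv T s
     else (-1) ^ k * (2 * of_nat k / deriv T s * Dhat T (k - 2) s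
                      - (t - T s) / deriv T s * Dhat T (k - 1) s))"

definition coeff4 ::
  "(complex \<Rightarrow> complex) \<Rightarrow> nat \<Rightarrow> complex \<Rightarrow> complex \<Rightarrow> complex \<Rightarrow> complex"
  where "coeff4 T k s t s0 =
    (if k = 1 then s - s0 - (t - T s) / deriv T s
     else (-1) ^ k * ((t - T s) / deriv T s) * Dhat T (k - 1) s)"

definition coeff5 ::
  "(complex \<Rightarrow> complex) \<Rightarrow> nat \<Rightarrow> complex \<Rightarrow> complex \<Rightarrow> complex \<Rightarrow> complex"
  where "coeff5 T k s t s0 =
    (if k = 1 then - (s - s0) - (t - T s) / deriv T s
     else (-1) ^ (k - 1) * ((2 * of_nat k - 4) / deriv T s * Dhat T (k - 2) s
                            - (t - T s) / deriv T s * Dhat T (k - 1) s))"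

definition half_V ::
  "((complex \<Rightarrow> complex) \<Rightarrow> nat \<Rightarrow> complex \<Rightarrow> complex \<Rightarrow> complex \<Rightarrow> complex) \<Rightarrow>
   (complex \<Rightarrow> complex) \<Rightarrow> complex \<Rightarrow> complex \<Rightarrow> complex \<Rightarrow> complex \<Rightarrow> complex"
  where "half_V cf T s t s0 t0 =
    (\<Sum>k. cf T (Suc k) s t s0 * (T s - t0) ^ Suc k / fact (Suc k))"

text \<open>\<open>V = V\<^sub>1 - V\<^sub>2\<close> as a function of the point \<open>z = x + \<i> y\<close> of the real plane, where
  \<open>w = cnj z\<close>, with the parameters \<open>z\<^sub>0 = P\<close> and \<open>w\<^sub>0 = cnj P\<close>.\<close>

definition V_fun ::
  "((complex \<Rightarrow> complex) \<Rightarrow> nat \<Rightarrow> complex \<Rightarrow> complex \<Rightarrow> complex \<Rightarrow> complex) \<Rightarrow>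
   (complex \<Rightarrow> complex) \<Rightarrow> (complex \<Rightarrow> complex) \<Rightarrow> complex \<Rightarrow> complex \<Rightarrow> complex"
  where "V_fun cf S St P z =
    half_V cf St (cnj z) z (cnj P) P - half_V cf S z (cnj z) P (cnj P)"

section \<open>The integral terms\<close>

definition line_integral ::
  "(complex \<Rightarrow> complex) \<Rightarrow> (complex \<Rightarrow> complex) \<Rightarrow> (real \<Rightarrow> complex) \<Rightarrow> complex"
  \<comment> \<open>the integral of \<open>A dx + B dy\<close> along \<open>\<gamma>\<close>\<close>
  where "line_integral A B \<gamma> = integral {0..1} (\<lambda>t.
    A (\<gamma> t) * of_real (Re (vector_derivative \<gamma> (at t within {0..1}))) +
    B (\<gamma> t) * of_real (Im (vector_derivative \<gamma> (at t within {0..1}))))"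

definition K_term :: "(complex \<Rightarrow> complex) \<Rightarrow> (complex \<Rightarrow> complex) \<Rightarrow> (real \<Rightarrow> complex) \<Rightarrow> complex"
  where "K_term V u \<gamma> = 1 / (8 * \<i>) * line_integral
    (\<lambda>q. V q * dy (laplacian u) q - laplacian u q * dy V q
         + laplacian V q * dy u q - u q * dy (laplacian V) q)
    (\<lambda>q. - (V q * dx (laplacian u) q - laplacian u q * dx V q
         + laplacian V q * dx u q - u q * dx (laplacian V) q)) \<gamma>"

definition joins_in :: "complex set \<Rightarrow> complex set \<Rightarrow> complex \<Rightarrow> (real \<Rightarrow> complex) \<Rightarrow> bool"
  where "joins_in U \<Gamma> Q \<gamma> \<longleftrightarrow> valid_path \<gamma> \<and> path_image \<gamma> \<subseteq> U \<and>
    pathstart \<gamma> \<in> \<Gamma> \<and> pathfinish \<gamma> = Q"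

section \<open>Sufficiently small domains\<close>

text \<open>\<open>U\<close> is a domain inside the disc of radius \<open>\<delta>\<close> about \<open>p\<close> which the curve \<open>\<Gamma>\<close>, the part
  of \<open>f = 0\<close> in \<open>U\<close>, divides into the two parts \<open>U1\<close> and \<open>U2\<close>. Smallness also covers
  the two topological conditions below, which hold for all discs about \<open>p\<close> of small radius.
  Smallness of the diameter alone would not do: if \<open>U \<inter> R(U)\<close> has a component away from
  \<open>\<Gamma>\<close> then the reflection formulas may fail there, as \<open>u\<close> need not be single-valued under
  continuation by reflection.\<close>

definition small_divided_domain ::
  "(complex \<Rightarrow> real) \<Rightarrow> (complex \<Rightarrow> complex) \<Rightarrow> complex \<Rightarrow> real \<Rightarrow>
   complex set \<Rightarrow> complex set \<Rightarrow> complex set \<Rightarrow> complex set \<Rightarrow> bool"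
  where "small_divided_domain f S p \<delta> U \<Gamma> U1 U2 \<longleftrightarrow>
    open U \<and> connected U \<and> U \<subseteq> ball p \<delta> \<and>
    \<Gamma> = {z\<in>U. f z = 0} \<and> connected \<Gamma> \<and>
    components (U - \<Gamma>) = {U1, U2} \<and> U1 \<noteq> U2 \<and>
    simply_connected U \<and> connected (U \<inter> reflection S ` U)"

end

theory Submission
  imports Defs "HOL-Complex_Analysis.Complex_Analysis"
begin

text \<open>By Goursat's representation \<open>u = 2 Re (cnj z A + B)\<close> with \<open>A\<close>, \<open>B\<close> holomorphic on \<open>U\<close>
  (\<open>goursat_representation\<close>), the biharmonic function \<open>u\<close> extends to the complex domain as
  \<open>w A(z) + B(z) + z A\<^sup>*(w) + B\<^sup>*(w)\<close> with \<open>F\<^sup>*(w) = cnj (F (cnj w))\<close>. On the curve \<open>w = S z\<close>, and so each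
  boundary condition is an equation between holomorphic functions of \<open>z\<close>. As the curve accumulates at
  each of its points, the equation persists, by the identity theorem, on the connected set \<open>W\<close> of the
  points of \<open>U\<close> whose reflection \<open>R z = cnj (S z)\<close> lies in \<open>U\<close>. It contains \<open>P\<close> and \<open>Q\<close>, where it
  relates values at \<open>P\<close> and \<open>Q\<close>, because \<open>S P = cnj Q\<close> and \<open>S Q = cnj P\<close>. If \<open>u = \<partial>\<^sub>n u = 0\<close> on the
  curve, these relations alone yield the formula (\<open>cauchy_reflection\<close>).

  In the other cases the series for \<open>V\<close> has to be summed. The operator that generates \<open>Dhat\<close> is
  differentiation with respect to \<open>S\<close> in disguise, so that \<open>Dhat\<close> gives the higher derivatives of the
  inverse function \<open>St\<close> (\<open>Dhat_eq_higher_deriv\<close>) and the series are Taylor series. The result is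
  \<open>V = a - cnj a\<close> with an explicit holomorphic function \<open>a\<close> (\<open>V_fun_coeff2\<close> to \<open>V_fun_coeff5\<close>). Thus \<open>V\<close>
  is harmonic, the form under the integral is exact, and a primitive of it is
  \<open>- 2 (Im a Im A' + Re E)\<close>, up to a constant factor, with \<open>E' = A' a'\<close> (\<open>K_term_eq\<close>). On \<open>W\<close> the
  boundary conditions allow to integrate \<open>A' a'\<close> in terms of \<open>A\<close>, \<open>B\<close>, \<open>S\<close> and \<open>R\<close>. This primitive is
  imaginary on the curve, and at \<open>Q\<close> its real part is \<open>- (u P + u Q) / 2\<close> or \<open>- (u P - u Q) / 2\<close>,
  depending on whether \<open>u = 0\<close> or \<open>\<partial>\<^sub>n u = 0\<close> on the curve (\<open>dirichlet_reflection\<close>,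
  \<open>neumann_reflection\<close>).\<close>

section \<open>Partial derivatives and the Laplacian\<close>

lemma dx_eqI:
  assumes "(g has_derivative g') (at z)"
  shows "dx g z = g' 1"
proof -
  have "(g \<circ> (\<lambda>t::real. z + of_real t) has_derivative g' \<circ> (\<lambda>t. of_real t)) (at 0)"
    by (rule diff_chain_at) (use assms in \<open>auto intro!: derivative_eq_intros\<close>)
  moreover have "g' \<circ> (\<lambda>t. of_real t) = (\<lambda>t. t *\<^sub>R g' 1)"
    using linear_cmul[OF has_derivative_linear[OF assms], of _ 1]
    by (auto simp: fun_eq_iff scaleR_conv_of_real)
  ultimately show ?thesis
    by (simp add: dx_def has_vector_derivative_def vector_derivative_at o_def)
qed

lemma dy_eqI:
  assumes "(g has_derivative g') (at z)"
  shows "dy g z = g' \<i>"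
proof -
  have "(g \<circ> (\<lambda>t::real. z + \<i> * of_real t) has_derivative g' \<circ> (\<lambda>t. \<i> * of_real t)) (at 0)"
    by (rule diff_chain_at) (use assms in \<open>auto intro!: derivative_eq_intros\<close>)
  moreover have "g' \<circ> (\<lambda>t. \<i> * of_real t) = (\<lambda>t. t *\<^sub>R g' \<i>)"
    using linear_cmul[OF has_derivative_linear[OF assms], of _ \<i>]
    by (auto simp: fun_eq_iff scaleR_conv_of_real mult.commute)
  ultimately show ?thesis
    by (simp add: dy_def has_vector_derivative_def vector_derivative_at o_def)
qed

lemma has_derivative_dx_dy:
  assumes "g differentiable (at z)"
  shows "(g has_derivative (\<lambda>v. Re v *\<^sub>R dx g z + Im v *\<^sub>R dy g z)) (at z)"
proof -
  obtain g' where g': "(g has_derivative g') (at z)"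
    using assms by (auto simp: differentiable_def)
  interpret g': bounded_linear g' by (rule has_derivative_bounded_linear[OF g'])
  have "g' v = Re v *\<^sub>R dx g z + Im v *\<^sub>R dy g z" for v
  proof -
    have "v = Re v *\<^sub>R 1 + Im v *\<^sub>R \<i>"
      by (simp add: complex_eq_iff)
    then show ?thesis
      by (metis dx_eqI[OF g'] dy_eqI[OF g'] g'.add g'.scaleR)
  qed
  then have "g' = (\<lambda>v. Re v *\<^sub>R dx g z + Im v *\<^sub>R dy g z)"
    by (simp add: fun_eq_iff)
  with g' show ?thesis by simp
qed

lemma eventually_shift_at_0:
  fixes z e :: complex
  assumes "open U" "z \<in> U"
  shows "eventually (\<lambda>t::real. z + e * of_real t \<in> U) (nhds 0)"
proof -
  have "((\<lambda>t::real. z + e * of_real t) \<longlongrightarrow> z + e * of_real 0) (nhds 0)"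
    by (intro tendsto_intros filterlim_ident)
  then show ?thesis
    using topological_tendstoD[of _ _ _ U] assms by fastforce
qed

lemma dx_cong:
  assumes "open U" "z \<in> U" "\<And>w. w \<in> U \<Longrightarrow> g w = h w"
  shows "dx g z = dx h z"
  unfolding dx_def
  by (rule vector_derivative_cong_eq)
     (use eventually_shift_at_0[OF assms(1,2), of 1] in \<open>auto elim!: eventually_mono simp: assms(3)\<close>)

lemma dy_cong:
  assumes "open U" "z \<in> U" "\<And>w. w \<in> U \<Longrightarrow> g w = h w"
  shows "dy g z = dy h z"
  unfolding dy_def
  by (rule vector_derivative_cong_eq)
     (use eventually_shift_at_0[OF assms(1,2), of \<i>] in \<open>auto elim!: eventually_mono simp: assms(3)\<close>)

lemma differentiable_cong_open:
  assumes "open U" "z \<in> U" "\<And>w. w \<in> U \<Longrightarrow> g w = h w" "h differentiable (at z)"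
  shows "g differentiable (at z)"
proof -
  obtain h' where "(h has_derivative h') (at z)"
    using assms(4) by (auto simp: differentiable_def)
  then have "(g has_derivative h') (at z)"
    by (rule has_derivative_transform_within_open[OF _ assms(1,2)]) (simp add: assms(3))
  then show ?thesis by (auto simp: differentiable_def)
qed

lemma dx_add:
  assumes "g differentiable (at z)" "h differentiable (at z)"
  shows "dx (\<lambda>w. g w + h w) z = dx g z + dx h z"
  using dx_eqI[OF has_derivative_add[OF has_derivative_dx_dy[OF assms(1)] has_derivative_dx_dy[OF assms(2)]]]
  by simp

lemma dy_add:
  assumes "g differentiable (at z)" "h differentiable (at z)"
  shows "dy (\<lambda>w. g w + h w) z = dy g z + dy h z"
  using dy_eqI[OF has_derivative_add[OF has_derivative_dx_dy[OF assms(1)] has_derivative_dx_dy[OF assms(2)]]]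
  by simp

lemma dx_diff:
  assumes "g differentiable (at z)" "h differentiable (at z)"
  shows "dx (\<lambda>w. g w - h w) z = dx g z - dx h z"
  using dx_eqI[OF has_derivative_diff[OF has_derivative_dx_dy[OF assms(1)] has_derivative_dx_dy[OF assms(2)]]]
  by simp

lemma dy_diff:
  assumes "g differentiable (at z)" "h differentiable (at z)"
  shows "dy (\<lambda>w. g w - h w) z = dy g z - dy h z"
  using dy_eqI[OF has_derivative_diff[OF has_derivative_dx_dy[OF assms(1)] has_derivative_dx_dy[OF assms(2)]]]
  by simp

lemma dx_of_real:
  assumes "g differentiable (at z)"
  shows "dx (\<lambda>w. complex_of_real (g w)) z = of_real (dx g z)"
  using dx_eqI[OF has_derivative_of_real[OF has_derivative_dx_dy[OF assms]]] by simp

lemma dy_of_real: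
  assumes "g differentiable (at z)"
  shows "dy (\<lambda>w. complex_of_real (g w)) z = of_real (dy g z)"
  using dy_eqI[OF has_derivative_of_real[OF has_derivative_dx_dy[OF assms]]] by simp

text \<open>The mean value theorem, applied to \<open>s \<mapsto> g (z + s a + t b) - g (z + s a)\<close>, expresses the second
  difference through the derivative in the direction \<open>a\<close>. As the second difference is
  symmetric in \<open>a\<close> and \<open>b\<close>, mixed second derivatives coincide.\<close>

lemma second_difference_tendsto:
  fixes g :: "complex \<Rightarrow> real"
  assumes "open U" "z \<in> U"
    and deriv: "\<And>w. w \<in> U \<Longrightarrow> (g has_derivative D w) (at w)"
    and second: "((\<lambda>w. D w a) has_derivative H) (at z)"
  shows "((\<lambda>t. (g (z + t *\<^sub>R a + t *\<^sub>R b) - g (z + t *\<^sub>R a) - g (z + t *\<^sub>R b) + g z) / t\<^sup>2)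
           \<longlongrightarrow> H b) (at_right 0)"
proof (rule tendstoI)
  fix e :: real assume "e > 0"
  interpret H: bounded_linear H by (rule has_derivative_bounded_linear[OF second])
  define C where "C = 2 * norm a + norm b + 1"
  have "C > 0" unfolding C_def by (smt (verit) norm_ge_zero)
  define e' where "e' = e / (2 * C)"
  have "e' > 0" using \<open>e > 0\<close> \<open>C > 0\<close> by (simp add: e'_def)
  obtain d1 where d1: "d1 > 0" "ball z d1 \<subseteq> U"
    using assms(1,2) openE by blast
  obtain d2 where d2: "d2 > 0"
      "\<And>w. norm (w - z) < d2 \<Longrightarrow> norm (D w a - D z a - H (w - z)) \<le> e' * norm (w - z)"
    using second \<open>e' > 0\<close> unfolding has_derivative_at_alt by blast
  define d where "d = min d1 d2 / C"
  have "d > 0" using d1 d2 \<open>C > 0\<close> by (simp add: d_def)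
  have close: "norm (s *\<^sub>R a + r *\<^sub>R b) \<le> C * t" if "0 \<le> s" "s \<le> t" "0 \<le> r" "r \<le> t" for s r t
  proof -
    have "norm (s *\<^sub>R a + r *\<^sub>R b) \<le> s * norm a + r * norm b"
      using norm_triangle_ineq[of "s *\<^sub>R a" "r *\<^sub>R b"] that by simp
    also have "\<dots> \<le> t * norm a + t * norm b"
      by (intro add_mono mult_right_mono) (use that in auto)
    also have "\<dots> \<le> C * t"
      using that by (simp add: C_def algebra_simps)
    finally show ?thesis .
  qed
  have "dist ((g (z + t *\<^sub>R a + t *\<^sub>R b) - g (z + t *\<^sub>R a) - g (z + t *\<^sub>R b) + g z) / t\<^sup>2) (H b) < e"
    if t: "0 < t" "t < d" for t
  proof -
    have Ct: "C * t < d1" "C * t < d2"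
      using t \<open>C > 0\<close> by (auto simp: d_def field_simps)
    have inU: "z + s *\<^sub>R a + r *\<^sub>R b \<in> U" if "0 \<le> s" "s \<le> t" "0 \<le> r" "r \<le> t" for s r
    proof -
      have "dist z (z + s *\<^sub>R a + r *\<^sub>R b) = norm (s *\<^sub>R a + r *\<^sub>R b)"
        by (metis add.assoc add_diff_cancel_left' dist_commute dist_norm)
      then show ?thesis
        using close[OF that] Ct d1 by (auto simp: subset_iff)
    qed
    define \<phi> where "\<phi> s = g (z + s *\<^sub>R a + t *\<^sub>R b) - g (z + s *\<^sub>R a)" for s
    have der: "(\<phi> has_real_derivative D (z + s *\<^sub>R a + t *\<^sub>R b) a - D (z + s *\<^sub>R a) a) (at s)"
      if s: "0 \<le> s" "s \<le> t" for s
    proof -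
      have 1: "((\<lambda>s. g (z + s *\<^sub>R a + r *\<^sub>R b)) has_derivative (\<lambda>v. v * D (z + s *\<^sub>R a + r *\<^sub>R b) a)) (at s)"
        if "z + s *\<^sub>R a + r *\<^sub>R b \<in> U" for r
      proof -
        have "(g \<circ> (\<lambda>s. z + s *\<^sub>R a + r *\<^sub>R b) has_derivative D (z + s *\<^sub>R a + r *\<^sub>R b) \<circ> (\<lambda>v. v *\<^sub>R a)) (at s)"
          by (rule diff_chain_at) (use deriv[OF that] in \<open>auto intro!: derivative_eq_intros\<close>)
        moreover have "D (z + s *\<^sub>R a + r *\<^sub>R b) \<circ> (\<lambda>v. v *\<^sub>R a) = (\<lambda>v. v * D (z + s *\<^sub>R a + r *\<^sub>R b) a)"
          using linear_cmul[OF has_derivative_linear[OF deriv[OF that]]] by (auto simp: fun_eq_iff)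
        ultimately show ?thesis by (simp add: o_def)
      qed
      have "(\<phi> has_derivative (\<lambda>v. v * D (z + s *\<^sub>R a + t *\<^sub>R b) a - v * D (z + s *\<^sub>R a) a)) (at s)"
        unfolding \<phi>_def
        using has_derivative_diff[OF 1[of t] 1[of 0]] inU[of s t] inU[of s 0] s t by simp
      then show ?thesis
        by (rule has_derivative_imp_has_field_derivative) (simp add: algebra_simps)
    qed
    obtain \<xi> where \<xi>: "0 < \<xi>" "\<xi> < t"
        "\<phi> t - \<phi> 0 = (t - 0) * (D (z + \<xi> *\<^sub>R a + t *\<^sub>R b) a - D (z + \<xi> *\<^sub>R a) a)"
      using MVT2[of 0 t \<phi>, OF t(1) der] by auto
    have n1: "norm (\<xi> *\<^sub>R a + t *\<^sub>R b) \<le> C * t" and n2: "norm (\<xi> *\<^sub>R a) \<le> C * t"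
      using close[of \<xi> t t] close[of \<xi> t 0] \<xi> t by auto
    have b1: "\<bar>D (z + \<xi> *\<^sub>R a + t *\<^sub>R b) a - D z a - H (\<xi> *\<^sub>R a + t *\<^sub>R b)\<bar> \<le> e' * norm (\<xi> *\<^sub>R a + t *\<^sub>R b)"
      using d2(2)[of "z + \<xi> *\<^sub>R a + t *\<^sub>R b"] n1 Ct by (simp add: add.assoc)
    have b2: "\<bar>D (z + \<xi> *\<^sub>R a) a - D z a - H (\<xi> *\<^sub>R a)\<bar> \<le> e' * norm (\<xi> *\<^sub>R a)"
      using d2(2)[of "z + \<xi> *\<^sub>R a"] n2 Ct by simp
    have "norm (\<xi> *\<^sub>R a + t *\<^sub>R b) + norm (\<xi> *\<^sub>R a) \<le> (C - 1) * t"
    proof -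
      have "norm (\<xi> *\<^sub>R a + t *\<^sub>R b) + norm (\<xi> *\<^sub>R a) \<le> 2 * (\<xi> * norm a) + t * norm b"
        using norm_triangle_ineq[of "\<xi> *\<^sub>R a" "t *\<^sub>R b"] \<xi> t by simp
      also have "\<dots> \<le> 2 * (t * norm a) + t * norm b"
        using \<xi> by (intro add_mono mult_left_mono mult_right_mono) auto
      finally show ?thesis by (simp add: C_def algebra_simps)
    qed
    also have "\<dots> \<le> C * t" using t by simp
    finally have "\<bar>D (z + \<xi> *\<^sub>R a + t *\<^sub>R b) a - D (z + \<xi> *\<^sub>R a) a - H (t *\<^sub>R b)\<bar> \<le> e' * (C * t)"
      using b1 b2 mult_left_mono[of _ "C * t" e'] \<open>e' > 0\<close>
      by (smt (verit) H.add distrib_left)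
    also have "e' * (C * t) = e / 2 * t" using \<open>C > 0\<close> by (simp add: e'_def)
    finally have bound: "\<bar>D (z + \<xi> *\<^sub>R a + t *\<^sub>R b) a - D (z + \<xi> *\<^sub>R a) a - t * H b\<bar> \<le> e / 2 * t"
      by (simp add: H.scaleR)
    define X where "X = D (z + \<xi> *\<^sub>R a + t *\<^sub>R b) a - D (z + \<xi> *\<^sub>R a) a"
    have "(g (z + t *\<^sub>R a + t *\<^sub>R b) - g (z + t *\<^sub>R a) - g (z + t *\<^sub>R b) + g z) = t * X"
      using \<xi>(3) by (simp add: \<phi>_def X_def algebra_simps)
    then have "(g (z + t *\<^sub>R a + t *\<^sub>R b) - g (z + t *\<^sub>R a) - g (z + t *\<^sub>R b) + g z) / t\<^sup>2 = X / t"
      using t by (simp add: power2_eq_square)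
    moreover have "\<bar>X / t - H b\<bar> = \<bar>X - t * H b\<bar> / t"
      using t by (simp add: field_simps abs_if)
    moreover have "\<dots> \<le> e / 2"
      using bound t by (simp add: X_def field_simps)
    ultimately have "\<bar>(g (z + t *\<^sub>R a + t *\<^sub>R b) - g (z + t *\<^sub>R a) - g (z + t *\<^sub>R b) + g z) / t\<^sup>2 - H b\<bar> \<le> e / 2"
      by (simp only:)
    then show ?thesis
      using \<open>e > 0\<close> unfolding dist_real_def by linarith
  qed
  then show "\<forall>\<^sub>F t in at_right 0. dist ((g (z + t *\<^sub>R a + t *\<^sub>R b) - g (z + t *\<^sub>R a) - g (z + t *\<^sub>R b) + g z) / t\<^sup>2) (H b) < e"
    using eventually_at_right_less[of 0] \<open>d > 0\<close>
    by (auto simp: eventually_at_right_field intro!: exI[of _ d])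
qed

lemma dx_dy_commute:
  fixes g :: "complex \<Rightarrow> real"
  assumes "open U" "z \<in> U"
    and "\<And>w. w \<in> U \<Longrightarrow> g differentiable (at w)"
    and "dx g differentiable (at z)" "dy g differentiable (at z)"
  shows "dx (dy g) z = dy (dx g) z"
proof -
  define D where "D w = (\<lambda>v. Re v *\<^sub>R dx g w + Im v *\<^sub>R dy g w)" for w
  have D: "(g has_derivative D w) (at w)" if "w \<in> U" for w
    unfolding D_def by (rule has_derivative_dx_dy[OF assms(3)[OF that]])
  have D1: "((\<lambda>w. D w 1) has_derivative (\<lambda>v. Re v *\<^sub>R dx (dx g) z + Im v *\<^sub>R dy (dx g) z)) (at z)"
    using has_derivative_dx_dy[OF assms(4)] by (simp add: D_def)
  have Di: "((\<lambda>w. D w \<i>) has_derivative (\<lambda>v. Re v *\<^sub>R dx (dy g) z + Im v *\<^sub>R dy (dy g) z)) (at z)"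
    using has_derivative_dx_dy[OF assms(5)] by (simp add: D_def)
  let ?q = "\<lambda>t. (g (z + t *\<^sub>R 1 + t *\<^sub>R \<i>) - g (z + t *\<^sub>R 1) - g (z + t *\<^sub>R \<i>) + g z) / t\<^sup>2"
  have "(?q \<longlongrightarrow> dy (dx g) z) (at_right 0)"
    using second_difference_tendsto[OF assms(1,2) D D1, of \<i>] by simp
  moreover have "(?q \<longlongrightarrow> dx (dy g) z) (at_right 0)"
    using second_difference_tendsto[OF assms(1,2) D Di, of 1] by (simp add: algebra_simps)
  ultimately show ?thesis
    by (intro tendsto_unique[of "at_right 0" ?q]) auto
qed

section \<open>Goursat's representation of biharmonic functions\<close>

lemma harmonic_imp_Re_holomorphic:
  fixes h :: "complex \<Rightarrow> real"
  assumes U: "open U" "simply_connected U"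
    and diff: "\<And>z. z \<in> U \<Longrightarrow> h differentiable (at z)"
      "\<And>z. z \<in> U \<Longrightarrow> dx h differentiable (at z)" "\<And>z. z \<in> U \<Longrightarrow> dy h differentiable (at z)"
    and harm: "\<And>z. z \<in> U \<Longrightarrow> laplacian h z = 0"
  obtains H where "H holomorphic_on U" "\<And>z. z \<in> U \<Longrightarrow> h z = Re (H z)"
proof -
  define k where "k z = complex_of_real (dx h z) - \<i> * of_real (dy h z)" for z
  \<comment> \<open>Laplace's equation and the symmetry of second derivatives are the Cauchy-Riemann equations for \<open>k\<close>.\<close>
  have "(k has_field_derivative (of_real (dx (dx h) z) - \<i> * of_real (dx (dy h) z))) (at z)"
    if z: "z \<in> U" for z
  proof -
    have CR: "dy (dy h) z = - dx (dx h) z" "dy (dx h) z = dx (dy h) z"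
      using harm[OF z] dx_dy_commute[OF U(1) z diff(1) diff(2)[OF z] diff(3)[OF z]]
      by (auto simp: laplacian_def)
    have "(k has_derivative (\<lambda>v. of_real (Re v *\<^sub>R dx (dx h) z + Im v *\<^sub>R dy (dx h) z)
              - \<i> * of_real (Re v *\<^sub>R dx (dy h) z + Im v *\<^sub>R dy (dy h) z))) (at z)"
      unfolding k_def
      by (intro derivative_intros has_derivative_dx_dy diff z)
    moreover have "(\<lambda>v. of_real (Re v *\<^sub>R dx (dx h) z + Im v *\<^sub>R dy (dx h) z)
              - \<i> * of_real (Re v *\<^sub>R dx (dy h) z + Im v *\<^sub>R dy (dy h) z))
        = (*) (of_real (dx (dx h) z) - \<i> * of_real (dx (dy h) z))"
      unfolding CR by (simp add: fun_eq_iff complex_eq_iff algebra_simps)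
    ultimately show ?thesis by (simp add: has_field_derivative_def)
  qed
  then have "k holomorphic_on U"
    using U(1) holomorphic_on_open by blast
  then obtain G where G: "\<And>z. z \<in> U \<Longrightarrow> (G has_field_derivative k z) (at z)"
    using simply_connected_eq_global_primitive[OF U(1)] U(2) by blast
  have "((\<lambda>z. h z - Re (G z)) has_derivative (\<lambda>v. 0)) (at z)" if z: "z \<in> U" for z
  proof -
    have "((\<lambda>z. h z - Re (G z)) has_derivative
        (\<lambda>v. (Re v *\<^sub>R dx h z + Im v *\<^sub>R dy h z) - Re (k z * v))) (at z)"
      using G[OF z] by (intro derivative_intros has_derivative_dx_dy diff z)
        (simp add: has_field_derivative_def)
    moreover have "(Re v *\<^sub>R dx h z + Im v *\<^sub>R dy h z) - Re (k z * v) = 0" for v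
      by (simp add: k_def)
    ultimately show ?thesis
      by (simp only:)
  qed
  then have "\<exists>c. \<forall>z\<in>U. h z - Re (G z) = c"
    using has_derivative_zero_unique_connected[OF U(1) simply_connected_imp_connected[OF U(2)], of "\<lambda>z. h z - Re (G z)"]
    by metis
  then obtain c where c: "\<And>z. z \<in> U \<Longrightarrow> h z - Re (G z) = c" by blast
  show thesis
  proof
    show "(\<lambda>z. G z + of_real c) holomorphic_on U"
      using G U(1) by (intro holomorphic_intros) (auto simp: holomorphic_on_open)
    show "h z = Re (G z + of_real c)" if "z \<in> U" for z
      using c[OF that] by simp
  qed
qed

text \<open>The functions \<open>Re (cnj z A + B)\<close> with \<open>A\<close>, \<open>B\<close> holomorphic are stable under both partial
  derivatives, which act on the pair \<open>(A, B)\<close> as follows.\<close>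

lemma goursat_has_derivative:
  assumes "open U" "z \<in> U" "A holomorphic_on U" "B holomorphic_on U"
    and u: "\<And>w. w \<in> U \<Longrightarrow> u w = 2 * Re (cnj w * A w + B w)"
  shows "(u has_derivative (\<lambda>v. 2 * Re (cnj v * A z + (cnj z * deriv A z + deriv B z) * v))) (at z)"
proof -
  have "(A has_derivative (*) (deriv A z)) (at z)" "(B has_derivative (*) (deriv B z)) (at z)"
    using assms by (auto simp: holomorphic_derivI has_field_derivative_def[symmetric])
  then have "((\<lambda>w. 2 * Re (cnj w * A w + B w)) has_derivative
      (\<lambda>v. 2 * Re (cnj z * (deriv A z * v) + cnj v * A z + deriv B z * v))) (at z)"
    by (intro derivative_intros)
  then have "(u has_derivative (\<lambda>v. 2 * Re (cnj z * (deriv A z * v) + cnj v * A z + deriv B z * v))) (at z)"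
    by (rule has_derivative_transform_within_open[OF _ assms(1,2)]) (simp add: u)
  then show ?thesis
    by (rule has_derivative_eq_rhs) (simp add: fun_eq_iff algebra_simps)
qed

lemma goursat_dx:
  assumes "open U" "z \<in> U" "A holomorphic_on U" "B holomorphic_on U"
    and u: "\<And>w. w \<in> U \<Longrightarrow> u w = 2 * Re (cnj w * A w + B w)"
  shows "dx u z = 2 * Re (cnj z * deriv A z + (A z + deriv B z))"
  using dx_eqI[OF goursat_has_derivative[OF assms]] by (simp add: algebra_simps)

lemma goursat_dy:
  assumes "open U" "z \<in> U" "A holomorphic_on U" "B holomorphic_on U"
    and u: "\<And>w. w \<in> U \<Longrightarrow> u w = 2 * Re (cnj w * A w + B w)"
  shows "dy u z = 2 * Re (cnj z * (\<i> * deriv A z) + (\<i> * deriv B z - \<i> * A z))"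
  using dy_eqI[OF goursat_has_derivative[OF assms]] by (simp add: algebra_simps)

lemma goursat_partials_differentiable:
  assumes "open U" "z \<in> U" "A holomorphic_on U" "B holomorphic_on U"
    and u: "\<And>w. w \<in> U \<Longrightarrow> u w = 2 * Re (cnj w * A w + B w)"
  shows "u differentiable (at z)" "dx u differentiable (at z)" "dy u differentiable (at z)"
proof -
  note hol = assms(3,4) holomorphic_deriv[OF assms(3,1)] holomorphic_deriv[OF assms(4,1)]
  show "u differentiable (at z)"
    using goursat_has_derivative[OF assms] by (auto simp: differentiable_def)
  have "(dx u has_derivative (\<lambda>v. 2 * Re (cnj v * deriv A z + (cnj z * deriv (deriv A) z + deriv (\<lambda>z. A z + deriv B z) z) * v))) (at z)"
    by (rule goursat_has_derivative[OF assms(1,2)])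
      (use goursat_dx[OF assms(1) _ assms(3-)] in \<open>auto intro!: holomorphic_intros hol\<close>)
  then show "dx u differentiable (at z)" by (auto simp: differentiable_def)
  have "(dy u has_derivative (\<lambda>v. 2 * Re (cnj v * (\<i> * deriv A z) + (cnj z * deriv (\<lambda>z. \<i> * deriv A z) z
          + deriv (\<lambda>z. \<i> * deriv B z - \<i> * A z) z) * v))) (at z)"
    by (rule goursat_has_derivative[OF assms(1,2)])
      (use goursat_dy[OF assms(1) _ assms(3-)] in \<open>auto intro!: holomorphic_intros hol\<close>)
  then show "dy u differentiable (at z)" by (auto simp: differentiable_def)
qed

lemma goursat_laplacian:
  assumes "open U" "z \<in> U" "A holomorphic_on U" "B holomorphic_on U"
    and u: "\<And>w. w \<in> U \<Longrightarrow> u w = 2 * Re (cnj w * A w + B w)"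
  shows "laplacian u z = 8 * Re (deriv A z)"
proof -
  note hol = assms(3,4) holomorphic_deriv[OF assms(3,1)] holomorphic_deriv[OF assms(4,1)]
  have d: "(A has_field_derivative deriv A z) (at z)" "(deriv A has_field_derivative deriv (deriv A) z) (at z)"
    "(deriv B has_field_derivative deriv (deriv B) z) (at z)"
    using hol assms by (auto intro: holomorphic_derivI)
  have "dx (dx u) z = 2 * Re (cnj z * deriv (deriv A) z + (deriv A z + deriv (\<lambda>z. A z + deriv B z) z))"
    by (rule goursat_dx[OF assms(1,2)])
      (use goursat_dx[OF assms(1) _ assms(3-)] in \<open>auto intro!: holomorphic_intros hol\<close>)
  moreover have "deriv (\<lambda>z. A z + deriv B z) z = deriv A z + deriv (deriv B) z"
    by (rule DERIV_imp_deriv) (auto intro!: derivative_eq_intros d)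
  moreover have "dy (dy u) z = 2 * Re (cnj z * (\<i> * deriv (\<lambda>z. \<i> * deriv A z) z)
      + (\<i> * deriv (\<lambda>z. \<i> * deriv B z - \<i> * A z) z - \<i> * (\<i> * deriv A z)))"
    by (rule goursat_dy[OF assms(1,2)])
      (use goursat_dy[OF assms(1) _ assms(3-)] in \<open>auto intro!: holomorphic_intros hol\<close>)
  moreover have "deriv (\<lambda>z. \<i> * deriv B z - \<i> * A z) z = \<i> * deriv (deriv B) z - \<i> * deriv A z"
    by (rule DERIV_imp_deriv) (auto intro!: derivative_eq_intros d)
  moreover have "deriv (\<lambda>z. \<i> * deriv A z) z = \<i> * deriv (deriv A) z"
    by (rule DERIV_imp_deriv) (auto intro!: derivative_eq_intros d)
  ultimately show ?thesis
    by (simp add: laplacian_def algebra_simps)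
qed

text \<open>The Laplacian of \<open>u\<close> is harmonic, say \<open>Re a\<close>. With a primitive \<open>A\<close> of \<open>a / 8\<close>, the function
  \<open>2 Re (cnj z A)\<close> has the same Laplacian, so that the difference of the two is harmonic.\<close>

theorem goursat_representation:
  assumes U: "open U" "simply_connected U" and u: "biharmonic_on u U"
  obtains A B where "A holomorphic_on U" "B holomorphic_on U"
    "\<And>z. z \<in> U \<Longrightarrow> u z = 2 * Re (cnj z * A z + B z)"
proof -
  have C4: "Ck_on 4 u U" and bih: "\<And>z. z \<in> U \<Longrightarrow> laplacian (laplacian u) z = 0"
    using u by (auto simp: biharmonic_on_def)
  have d: "u differentiable (at z)" "dx u differentiable (at z)" "dy u differentiable (at z)"
    "dx (dx u) differentiable (at z)" "dy (dy u) differentiable (at z)"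
    "dx (dx (dx u)) differentiable (at z)" "dx (dy (dy u)) differentiable (at z)"
    "dy (dx (dx u)) differentiable (at z)" "dy (dy (dy u)) differentiable (at z)"
    if "z \<in> U" for z
    using C4 that by (auto simp: numeral_eq_Suc)
  have lap: "laplacian u = (\<lambda>z. dx (dx u) z + dy (dy u) z)"
    by (simp add: laplacian_def fun_eq_iff)
  have "laplacian u differentiable (at z)" if "z \<in> U" for z
    unfolding lap by (intro differentiable_add d that)
  moreover have "dx (laplacian u) differentiable (at z)" if "z \<in> U" for z
    by (rule differentiable_cong_open[OF U(1) that, where h = "\<lambda>z. dx (dx (dx u)) z + dx (dy (dy u)) z"])
       (auto simp: lap intro!: dx_add d differentiable_add that)
  moreover have "dy (laplacian u) differentiable (at z)" if "z \<in> U" for z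
    by (rule differentiable_cong_open[OF U(1) that, where h = "\<lambda>z. dy (dx (dx u)) z + dy (dy (dy u)) z"])
       (auto simp: lap intro!: dy_add d differentiable_add that)
  ultimately obtain a where a: "a holomorphic_on U" "\<And>z. z \<in> U \<Longrightarrow> laplacian u z = Re (a z)"
    using harmonic_imp_Re_holomorphic[OF U, of "laplacian u"] bih by metis
  obtain A where A: "\<And>z. z \<in> U \<Longrightarrow> (A has_field_derivative a z / 8) (at z)"
    using simply_connected_eq_global_primitive[OF U(1)] U(2) holomorphic_on_divide[OF a(1), of "\<lambda>_. 8"]
    by auto
  have holA: "A holomorphic_on U" using A U(1) holomorphic_on_open by blast
  define p where "p z = 2 * Re (cnj z * A z + 0)" for z
  note pd = goursat_partials_differentiable[OF U(1) _ holA holomorphic_on_const p_def]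
  have lap_p: "laplacian p z = laplacian u z" if "z \<in> U" for z
    using goursat_laplacian[OF U(1) that holA holomorphic_on_const p_def] a(2)[OF that]
      DERIV_imp_deriv[OF A[OF that]] by simp
  define v where "v z = u z - p z" for z
  have dxv: "dx v z = dx u z - dx p z" and dyv: "dy v z = dy u z - dy p z" if "z \<in> U" for z
    unfolding v_def by (intro dx_diff dy_diff d pd that)+
  have "v differentiable (at z)" if "z \<in> U" for z
    unfolding v_def by (intro differentiable_diff d pd that)
  moreover have "dx v differentiable (at z)" if "z \<in> U" for z
    by (rule differentiable_cong_open[OF U(1) that, where h = "\<lambda>z. dx u z - dx p z"])
       (auto simp: dxv intro!: differentiable_diff d pd that)
  moreover have "dy v differentiable (at z)" if "z \<in> U" for z
    by (rule differentiable_cong_open[OF U(1) that, where h = "\<lambda>z. dy u z - dy p z"])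
       (auto simp: dyv intro!: differentiable_diff d pd that)
  moreover have "laplacian v z = 0" if "z \<in> U" for z
  proof -
    have "dx (dx v) z = dx (\<lambda>z. dx u z - dx p z) z" "dy (dy v) z = dy (\<lambda>z. dy u z - dy p z) z"
      using dx_cong[OF U(1) that, of "dx v" "\<lambda>z. dx u z - dx p z"]
        dy_cong[OF U(1) that, of "dy v" "\<lambda>z. dy u z - dy p z"] dxv dyv by blast+
    then have "dx (dx v) z = dx (dx u) z - dx (dx p) z" "dy (dy v) z = dy (dy u) z - dy (dy p) z"
      by (simp_all add: dx_diff dy_diff d pd that)
    then show ?thesis
      using lap_p[OF that] by (simp add: laplacian_def)
  qed
  ultimately obtain H where H: "H holomorphic_on U" "\<And>z. z \<in> U \<Longrightarrow> v z = Re (H z)"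
    using harmonic_imp_Re_holomorphic[OF U, of v] by metis
  show thesis
  proof (rule that[of A "\<lambda>z. H z / 2"])
    show "(\<lambda>z. H z / 2) holomorphic_on U" by (intro holomorphic_intros H) auto
    show "u z = 2 * Re (cnj z * A z + H z / 2)" if "z \<in> U" for z
      using H(2)[OF that] by (simp add: v_def p_def)
  qed (rule holA)
qed

section \<open>The zero set of a real analytic function at a non-singular point\<close>

text \<open>Without its constant and linear terms the series at \<open>q + v\<close> is dominated by
  \<open>(\<bar>v\<bar> / \<rho>)\<^sup>2\<close> times the absolutely convergent series at \<open>q + \<rho> + \<i> \<rho>\<close>.\<close>

lemma has_xy_expansion_has_derivative:
  assumes exp: "has_xy_expansion f c q r" and "r > 0"
  shows "(f has_derivative (\<lambda>v. c 1 0 * Re v + c 0 1 * Im v)) (at q)"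
proof -
  define \<rho> where "\<rho> = r / 2"
  have \<rho>: "0 < \<rho>" "\<rho> < r" using \<open>r > 0\<close> by (auto simp: \<rho>_def)
  define C where "C = infsum (\<lambda>(m, n). \<bar>c m n\<bar> * \<rho> ^ (m + n)) UNIV"
  have "((\<lambda>(m, n). c m n * \<rho> ^ m * \<rho> ^ n) has_sum f (q + Complex \<rho> \<rho>)) UNIV"
    using exp \<rho> unfolding has_xy_expansion_def by (auto dest!: spec[of _ "q + Complex \<rho> \<rho>"])
  then have "(\<lambda>(m, n). c m n * \<rho> ^ m * \<rho> ^ n) summable_on UNIV"
    by (rule has_sum_imp_summable)
  then have "(\<lambda>x. norm (case x of (m, n) \<Rightarrow> c m n * \<rho> ^ m * \<rho> ^ n)) summable_on UNIV"
    using summable_on_iff_abs_summable_on_real by blast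
  moreover have "norm (case x of (m, n) \<Rightarrow> c m n * \<rho> ^ m * \<rho> ^ n) = (case x of (m, n) \<Rightarrow> \<bar>c m n\<bar> * \<rho> ^ (m + n))" for x
    using \<rho> by (simp add: case_prod_unfold abs_mult power_add)
  ultimately have "(\<lambda>(m, n). \<bar>c m n\<bar> * \<rho> ^ (m + n)) summable_on UNIV"
    by simp
  then have C: "((\<lambda>(m, n). \<bar>c m n\<bar> * \<rho> ^ (m + n)) has_sum C) UNIV"
    unfolding C_def by (rule has_sum_infsum)
  have "C \<ge> 0" unfolding C_def using \<rho> by (intro infsum_nonneg) auto
  have taylor: "\<bar>f (q + v) - (c 0 0 + c 1 0 * Re v + c 0 1 * Im v)\<bar> \<le> C / \<rho>\<^sup>2 * (norm v)\<^sup>2"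
    if v: "norm v \<le> \<rho>" for v
  proof -
    let ?F = "{(0, 0), (1, 0), (0, 1)} :: (nat \<times> nat) set"
    let ?t = "\<lambda>(m, n). c m n * Re v ^ m * Im v ^ n"
    have "\<bar>Re v\<bar> < r" "\<bar>Im v\<bar> < r"
      using abs_Re_le_cmod[of v] abs_Im_le_cmod[of v] v \<rho> by linarith+
    then have "(?t has_sum f (q + v)) UNIV"
      using exp unfolding has_xy_expansion_def by (auto dest!: spec[of _ "q + v"])
    then have "(?t has_sum (f (q + v) - sum ?t ?F)) (UNIV - ?F)"
      by (intro has_sum_Diff has_sum_finite) auto
    moreover have "sum ?t ?F = c 0 0 + c 1 0 * Re v + c 0 1 * Im v"
      by simp
    ultimately have hs: "(?t has_sum (f (q + v) - (c 0 0 + c 1 0 * Re v + c 0 1 * Im v))) (UNIV - ?F)"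
      by (simp only:)
    then have "(\<lambda>x. norm (?t x)) summable_on (UNIV - ?F)"
      using has_sum_imp_summable summable_on_iff_abs_summable_on_real by blast
    then obtain N where N: "((\<lambda>x. norm (?t x)) has_sum N) (UNIV - ?F)"
      using summable_on_def by blast
    have "\<bar>f (q + v) - (c 0 0 + c 1 0 * Re v + c 0 1 * Im v)\<bar> \<le> N"
      using norm_has_sum_bound[OF N hs] by simp
    also have "N \<le> C * ((norm v)\<^sup>2 / \<rho>\<^sup>2)"
    proof (rule has_sum_mono_neutral[OF N has_sum_cmult_left[OF C]])
      fix x :: "nat \<times> nat" assume x: "x \<in> (UNIV - ?F) \<inter> UNIV"
      obtain m n where mn: "x = (m, n)" by (cases x)
      have "2 \<le> m + n" using x mn by (cases m; cases n; auto)
      then obtain k where k: "m + n = 2 + k" using le_Suc_ex by blast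
      have "\<bar>Re v\<bar> ^ m * \<bar>Im v\<bar> ^ n \<le> norm v ^ m * norm v ^ n"
        by (intro mult_mono power_mono abs_Re_le_cmod abs_Im_le_cmod) auto
      also have "\<dots> = (norm v)\<^sup>2 * norm v ^ k"
        by (simp add: k flip: power_add)
      also have "\<dots> \<le> (norm v)\<^sup>2 * \<rho> ^ k"
        using v by (intro mult_left_mono power_mono) auto
      also have "\<dots> = \<rho> ^ (m + n) * ((norm v)\<^sup>2 / \<rho>\<^sup>2)"
        using \<rho> by (simp add: k power_add power2_eq_square)
      finally have "\<bar>c m n\<bar> * (\<bar>Re v\<bar> ^ m * \<bar>Im v\<bar> ^ n) \<le> \<bar>c m n\<bar> * (\<rho> ^ (m + n) * ((norm v)\<^sup>2 / \<rho>\<^sup>2))"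
        by (rule mult_left_mono) simp
      then show "norm (?t x) \<le> (case x of (m, n) \<Rightarrow> \<bar>c m n\<bar> * \<rho> ^ (m + n)) * ((norm v)\<^sup>2 / \<rho>\<^sup>2)"
        by (simp add: mn abs_mult power_abs mult.assoc)
    qed (use \<rho> in \<open>auto simp: case_prod_unfold\<close>)
    finally show ?thesis by (simp add: mult.commute)
  qed
  have f0: "f q = c 0 0"
    using taylor[of 0] \<rho> by simp
  show ?thesis
    unfolding has_derivative_at_alt
  proof (intro conjI allI impI)
    show "bounded_linear (\<lambda>v. c 1 0 * Re v + c 0 1 * Im v)"
      by (intro bounded_linear_add bounded_linear_const_mult bounded_linear_Re bounded_linear_Im)
    fix e :: real assume "e > 0"
    define d where "d = min \<rho> (e * \<rho>\<^sup>2 / (C + 1))"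
    have "d > 0" using \<open>e > 0\<close> \<rho> \<open>C \<ge> 0\<close> by (simp add: d_def)
    moreover have "norm (f y - f q - (c 1 0 * Re (y - q) + c 0 1 * Im (y - q))) \<le> e * norm (y - q)"
      if y: "norm (y - q) < d" for y
    proof -
      have "norm (f y - f q - (c 1 0 * Re (y - q) + c 0 1 * Im (y - q))) \<le> C / \<rho>\<^sup>2 * (norm (y - q))\<^sup>2"
        using taylor[of "y - q"] y by (simp add: d_def f0 algebra_simps)
      also have "\<dots> \<le> (C + 1) / \<rho>\<^sup>2 * norm (y - q) * norm (y - q)"
        using \<rho> by (auto simp: power2_eq_square algebra_simps intro!: divide_right_mono)
      also have "(C + 1) / \<rho>\<^sup>2 * norm (y - q) \<le> e"
        using y \<rho> \<open>C \<ge> 0\<close> by (simp add: d_def field_simps)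
      finally show ?thesis by (simp add: mult_right_mono)
    qed
    ultimately show "\<exists>d>0. \<forall>y. norm (y - q) < d \<longrightarrow>
        norm (f y - f q - (c 1 0 * Re (y - q) + c 0 1 * Im (y - q))) \<le> e * norm (y - q)"
      by blast
  qed
qed

lemma real_analytic_on_differentiable:
  assumes "real_analytic_on f \<Omega>" "q \<in> \<Omega>"
  shows "f differentiable (at q)"
  using assms has_xy_expansion_has_derivative unfolding real_analytic_on_def differentiable_def by blast

text \<open>Along the gradient \<open>f\<close> changes sign at \<open>q\<close>. As a punctured disc is connected, \<open>f\<close> vanishes
  somewhere in every punctured disc about \<open>q\<close>.\<close>

lemma islimpt_zero_set:
  fixes f :: "complex \<Rightarrow> real"
  assumes "open \<Omega>" "q \<in> \<Omega>" and diff: "\<And>z. z \<in> \<Omega> \<Longrightarrow> f differentiable (at z)"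
    and grad: "dx f q \<noteq> 0 \<or> dy f q \<noteq> 0" and "f q = 0"
  shows "q islimpt {z\<in>\<Omega>. f z = 0}"
  unfolding islimpt_approachable
proof (intro allI impI)
  fix e :: real assume "e > 0"
  obtain e1 where e1: "e1 > 0" "ball q e1 \<subseteq> \<Omega>"
    using assms(1,2) openE by blast
  define d where "d = min e e1"
  have d: "d > 0" "ball q d \<subseteq> \<Omega>" using e1 \<open>e > 0\<close> by (auto simp: d_def)
  define w where "w = Complex (dx f q) (dy f q)"
  have "w \<noteq> 0" using grad by (auto simp: w_def complex_eq_iff)
  define g where "g t = f (q + t *\<^sub>R w)" for t
  have "(f \<circ> (\<lambda>t. q + t *\<^sub>R w) has_derivative (\<lambda>v. Re v *\<^sub>R dx f q + Im v *\<^sub>R dy f q) \<circ> (\<lambda>t. t *\<^sub>R w)) (at 0)"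
    by (rule diff_chain_at)
       (use has_derivative_dx_dy[OF diff[OF \<open>q \<in> \<Omega>\<close>]] in \<open>auto intro!: derivative_eq_intros\<close>)
  then have "(g has_real_derivative (norm w)\<^sup>2) (at 0)"
    unfolding g_def o_def
    by (rule has_derivative_imp_has_field_derivative)
       (simp add: w_def cmod_def power2_eq_square algebra_simps)
  moreover have "(norm w)\<^sup>2 > 0" using \<open>w \<noteq> 0\<close> by simp
  ultimately obtain d1 d2 where d1: "d1 > 0" "\<And>h. 0 < h \<Longrightarrow> h < d1 \<Longrightarrow> g 0 < g (0 + h)"
    and d2: "d2 > 0" "\<And>h. 0 < h \<Longrightarrow> h < d2 \<Longrightarrow> g (0 - h) < g 0"
    using DERIV_pos_inc_right[of g _ 0] DERIV_pos_inc_left[of g _ 0] by metis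
  define m where "m = min (min d1 d2) (d / norm w)"
  have "0 < m" "m \<le> d1" "m \<le> d2" "m \<le> d / norm w"
    using d1(1) d2(1) divide_pos_pos[OF d(1), of "norm w"] \<open>w \<noteq> 0\<close> by (auto simp: m_def)
  define h where "h = m / 2"
  have h: "0 < h" "h < d1" "h < d2" "h < d / norm w"
    using \<open>0 < m\<close> \<open>m \<le> d1\<close> \<open>m \<le> d2\<close> \<open>m \<le> d / norm w\<close> unfolding h_def by linarith+
  have hw: "h * norm w < d"
    using h(4) \<open>w \<noteq> 0\<close> by (simp add: pos_less_divide_eq)
  let ?B = "ball q d - {q}"
  have in_B: "q + h *\<^sub>R w \<in> ?B" "q - h *\<^sub>R w \<in> ?B"
    using hw h \<open>w \<noteq> 0\<close> by (auto simp: dist_norm)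
  have pos: "f (q + h *\<^sub>R w) > 0" and neg: "f (q - h *\<^sub>R w) < 0"
    using d1(2)[OF h(1,2)] d2(2)[OF h(1,3)] \<open>f q = 0\<close> by (auto simp: g_def)
  have "continuous_on ?B f"
    using d(2) diff by (intro continuous_at_imp_continuous_on ballI differentiable_imp_continuous_within) auto
  moreover have "connected ?B"
    by (rule connected_open_delete) auto
  ultimately have "connected (f ` ?B)"
    by (rule connected_continuous_image)
  then have "0 \<in> f ` ?B"
    using connectedD_interval[of "f ` ?B" "f (q - h *\<^sub>R w)" "f (q + h *\<^sub>R w)" 0] in_B pos neg by auto
  then obtain z where "z \<in> ?B" "f z = 0" by (metis imageE)
  then show "\<exists>x'\<in>{z\<in>\<Omega>. f z = 0}. x' \<noteq> q \<and> dist x' q < e"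
    using d by (intro bexI[of _ z]) (auto simp: d_def dist_commute)
qed

text \<open>\<open>\<tau>\<close> is a limit of directions of secants from \<open>q\<close> to points of \<open>Z\<close>.\<close>

lemma tangent_direction:
  fixes h :: "complex \<Rightarrow> 'b::real_normed_vector"
  assumes L: "(h has_derivative L) (at q)" and "q islimpt Z" and "\<And>z. z \<in> Z \<Longrightarrow> h z = h q"
  obtains \<tau> where "norm \<tau> = 1" "L \<tau> = 0"
proof -
  interpret L: bounded_linear L by (rule has_derivative_bounded_linear[OF L])
  obtain x where x: "\<And>n. x n \<in> Z - {q}" "x \<longlonglongrightarrow> q"
    using assms(2) islimpt_sequential by blast
  define y where "y n = (x n - q) /\<^sub>R norm (x n - q)" for n
  have "\<forall>n. y n \<in> sphere 0 1"
    using x(1) by (auto simp: y_def)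
  then obtain \<tau> r where \<tau>: "\<tau> \<in> sphere 0 1" "strict_mono (r :: nat \<Rightarrow> nat)" "(y \<circ> r) \<longlonglongrightarrow> \<tau>"
    using compact_sphere[of "0::complex" 1] unfolding compact_def by metis
  have "(\<lambda>n. x n - q) \<longlonglongrightarrow> 0"
    using x(2) by (simp add: LIM_zero)
  then have "filterlim (\<lambda>n. x n - q) (at 0) sequentially"
    using x(1) by (auto simp: filterlim_at)
  moreover have "((\<lambda>v. norm (h (q + v) - h q - L v) / norm v) \<longlongrightarrow> 0) (at 0)"
    using L unfolding has_derivative_at by simp
  ultimately have "(\<lambda>n. norm (h (q + (x n - q)) - h q - L (x n - q)) / norm (x n - q)) \<longlonglongrightarrow> 0"
    by (rule filterlim_compose[rotated])
  moreover have "norm (h (q + (x n - q)) - h q - L (x n - q)) / norm (x n - q) = norm (L (y n))" for n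
    using assms(3)[of "x n"] x(1)[of n] by (simp add: y_def L.scaleR divide_inverse mult.commute)
  ultimately have "(\<lambda>n. L (y n)) \<longlonglongrightarrow> 0"
    by (simp add: tendsto_norm_zero_iff)
  then have "(\<lambda>n. L ((y \<circ> r) n)) \<longlonglongrightarrow> 0"
    using LIMSEQ_subseq_LIMSEQ[OF _ \<tau>(2)] by (fastforce simp: o_def)
  moreover have "(\<lambda>n. L ((y \<circ> r) n)) \<longlonglongrightarrow> L \<tau>"
    by (rule L.tendsto[OF \<tau>(3)])
  ultimately have "L \<tau> = 0" by (rule LIMSEQ_unique[rotated])
  with \<tau>(1) show thesis by (intro that) auto
qed

text \<open>On the curve \<open>S z = cnj z\<close>, hence \<open>S' \<tau> = cnj \<tau>\<close> for a tangent vector \<open>\<tau>\<close>; the gradient is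
  a real multiple of \<open>\<i> \<tau>\<close>.\<close>

lemma schwarz_deriv_gradient:
  assumes "f differentiable (at q)" and "(S has_field_derivative S') (at q)" and "q islimpt Z"
    and "\<And>z. z \<in> Z \<Longrightarrow> f z = 0 \<and> S z = cnj z" and "f q = 0" "S q = cnj q"
  shows "S' * Complex (dx f q) (dy f q) = - cnj (Complex (dx f q) (dy f q))"
proof -
  let ?\<nu> = "Complex (dx f q) (dy f q)"
  have "((\<lambda>z. (f z, S z - cnj z)) has_derivative
      (\<lambda>v. (Re v *\<^sub>R dx f q + Im v *\<^sub>R dy f q, S' * v - cnj v))) (at q)"
    using assms(2) by (intro derivative_intros has_derivative_dx_dy assms) (simp add: has_field_derivative_def)
  then obtain \<tau> where \<tau>: "norm \<tau> = 1" "Re \<tau> * dx f q + Im \<tau> * dy f q = 0" "S' * \<tau> = cnj \<tau>"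
    by (rule tangent_direction[OF _ assms(3)]) (use assms(4-) in \<open>auto simp: prod_eq_iff\<close>)
  have "?\<nu> * cnj \<tau> = - (cnj ?\<nu> * \<tau>)"
    using \<tau>(2) by (simp add: complex_eq_iff algebra_simps)
  then have "(S' * ?\<nu>) * cnj \<tau> = (- cnj ?\<nu>) * cnj \<tau>"
    using \<tau>(3) by (metis (no_types, lifting) mult.assoc mult.commute mult_minus_left mult_minus_right)
  then show ?thesis
    using \<tau>(1) by (metis complex_cnj_zero_iff mult_cancel_right norm_zero zero_neq_one)
qed

text \<open>In complex notation, \<open>\<partial>\<^sub>n g = 0\<close> is \<open>g\<^sub>z = S' g\<^sub>w\<close>, since \<open>S'\<close> determines the direction of the
  gradient of \<open>f\<close>.\<close>

lemma normal_deriv_zero_imp: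
  assumes S': "S' * Complex (dx f q) (dy f q) = - cnj (Complex (dx f q) (dy f q))"
    and grad: "dx f q \<noteq> 0 \<or> dy f q \<noteq> 0" and zero: "normal_deriv f g q = 0"
  shows "of_real (dx g q) - \<i> * of_real (dy g q) = S' * (of_real (dx g q) + \<i> * of_real (dy g q))"
proof -
  let ?\<nu> = "Complex (dx f q) (dy f q)"
  let ?g = "Complex (dx g q) (- dy g q)"
  have "(dx f q)\<^sup>2 + (dy f q)\<^sup>2 \<noteq> 0"
    using grad by (simp add: sum_power2_eq_zero_iff)
  then have "dx f q * dx g q + dy f q * dy g q = 0"
    using zero grad by (auto simp: normal_deriv_def)
  then have "?\<nu> * ?g = - (cnj ?\<nu> * cnj ?g)"
    by (simp add: complex_eq_iff algebra_simps)
  also have "\<dots> = ?\<nu> * (S' * cnj ?g)"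
    using S' by (metis mult.assoc mult.commute mult_minus_left)
  finally have "?\<nu> * ?g = ?\<nu> * (S' * cnj ?g)" .
  moreover have "?\<nu> \<noteq> 0"
    using grad by (simp add: complex_eq_iff)
  ultimately have "?g = S' * cnj ?g"
    by (metis mult_left_cancel)
  moreover have "?g = of_real (dx g q) - \<i> * of_real (dy g q)" "cnj ?g = of_real (dx g q) + \<i> * of_real (dy g q)"
    by (simp_all add: complex_eq_iff)
  ultimately show ?thesis by metis
qed

section \<open>Summation of the series for \<open>V\<close>\<close>

locale inverse_pair =
  fixes T Ti :: "complex \<Rightarrow> complex" and X Y :: "complex set"
  assumes open_X: "open X" and open_Y: "open Y"
    and T_holo: "T holomorphic_on X" and Ti_holo: "Ti holomorphic_on Y"
    and T_in_Y: "\<And>s. s \<in> X \<Longrightarrow> T s \<in> Y" and Ti_T: "\<And>s. s \<in> X \<Longrightarrow> Ti (T s) = s"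
begin

lemma deriv_inverse:
  assumes "s \<in> X"
  shows "deriv T s \<noteq> 0" "1 / deriv T s = deriv Ti (T s)"
proof -
  have "((\<lambda>s. Ti (T s)) has_field_derivative deriv Ti (T s) * deriv T s) (at s)"
    using DERIV_chain2[OF holomorphic_derivI[OF Ti_holo open_Y T_in_Y[OF assms]]
        holomorphic_derivI[OF T_holo open_X assms]] .
  moreover have "((\<lambda>s. Ti (T s)) has_field_derivative 1) (at s)"
    by (rule DERIV_cong_ev[THEN iffD2, OF refl _ refl DERIV_ident])
       (use eventually_nhds_in_open[OF open_X assms] in \<open>auto elim!: eventually_mono simp: Ti_T\<close>)
  ultimately have "deriv Ti (T s) * deriv T s = 1"
    by (rule DERIV_unique)
  then show "deriv T s \<noteq> 0" "1 / deriv T s = deriv Ti (T s)"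
    by (auto simp: divide_eq_eq)
qed

text \<open>The operator \<open>g \<mapsto> (g / T')'\<close>, in the coordinate \<open>T s\<close> and after division by \<open>T'\<close>, is the ordinary
  derivative.\<close>

lemma Dhat_eq_higher_deriv:
  assumes "s \<in> X"
  shows "1 / deriv T s * Dhat T m s = (deriv ^^ Suc m) Ti (T s)"
  using assms
proof (induction m arbitrary: s)
  case 0
  then show ?case by (simp add: deriv_inverse)
next
  case (Suc m)
  have "Dhat T (Suc m) s = deriv (\<lambda>s. (deriv ^^ Suc m) Ti (T s)) s"
    unfolding Dhat.simps
    by (rule deriv_cong_ev)
       (use eventually_nhds_in_open[OF open_X Suc.prems] Suc.IH in \<open>auto elim!: eventually_mono simp del: funpow.simps\<close>)
  also have "\<dots> = (deriv ^^ Suc (Suc m)) Ti (T s) * deriv T s"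
    using DERIV_chain2[OF holomorphic_derivI[OF holomorphic_higher_deriv[OF Ti_holo open_Y, of "Suc m"] open_Y T_in_Y[OF Suc.prems]]
        holomorphic_derivI[OF T_holo open_X Suc.prems]]
    by (intro DERIV_imp_deriv) simp
  finally show ?case
    using deriv_inverse(1)[OF Suc.prems] by (simp del: funpow.simps Dhat.simps)
qed

end

lemma taylor_sums:
  fixes F :: "complex \<Rightarrow> complex"
  assumes "F holomorphic_on ball w r" "t0 \<in> ball w r"
  shows "(\<lambda>k. (-1) ^ k * (deriv ^^ Suc k) F w * (w - t0) ^ Suc k / fact (Suc k)) sums (F w - F t0)"
proof -
  have "(\<lambda>n. (deriv ^^ n) F w / fact n * (t0 - w) ^ n) sums F t0"
    by (rule holomorphic_power_series[OF assms])
  then have "(\<lambda>n. (deriv ^^ Suc n) F w / fact (Suc n) * (t0 - w) ^ Suc n) sums (F t0 - F w)"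
    by (subst sums_Suc_iff) (simp del: fact_Suc)
  then have "(\<lambda>n. - ((deriv ^^ Suc n) F w / fact (Suc n) * (t0 - w) ^ Suc n)) sums - (F t0 - F w)"
    by (rule sums_minus)
  moreover have "- ((deriv ^^ Suc n) F w / fact (Suc n) * (t0 - w) ^ Suc n)
      = (-1) ^ n * (deriv ^^ Suc n) F w * (w - t0) ^ Suc n / fact (Suc n)" for n
    using power_minus[of "w - t0" "Suc n"] by (simp del: fact_Suc funpow.simps)
  ultimately show ?thesis by simp
qed

text \<open>The terms are those of Taylor's series for \<open>F t0\<close> about \<open>w\<close>, with the sign reversed and the
  constant term dropped, so that their sum is \<open>F w - F t0\<close>.\<close>

definition taylor_term :: "(complex \<Rightarrow> complex) \<Rightarrow> complex \<Rightarrow> complex \<Rightarrow> nat \<Rightarrow> complex"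
  where "taylor_term F w t0 k = (-1) ^ k * (deriv ^^ Suc k) F w * (w - t0) ^ Suc k / fact (Suc k)"

lemma shifted_sums:
  fixes g :: "nat \<Rightarrow> 'a::real_normed_vector"
  assumes "g sums l"
  shows "(\<lambda>j. case j of 0 \<Rightarrow> 0 | Suc i \<Rightarrow> g i) sums l"
  using sums_Suc[of "\<lambda>j. case j of 0 \<Rightarrow> 0 | Suc i \<Rightarrow> g i" l] assms by simp

lemma first_term_sums: "(\<lambda>j. if j = 0 then c else 0) sums (c :: complex)"
  using sums_single[of 0 "\<lambda>_. c"] by simp

context inverse_pair
begin

lemma Dhat_taylor_term:
  assumes "s \<in> X"
  shows "(-1) ^ j * (1 / deriv T s * Dhat T j s) * (T s - t0) ^ Suc j / fact (Suc j) = taylor_term Ti (T s) t0 j"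
  unfolding Dhat_eq_higher_deriv[OF assms] taylor_term_def ..

lemma taylor_term_sums:
  assumes "s \<in> X" "ball (T s) r \<subseteq> Y" "t0 \<in> ball (T s) r"
  shows "taylor_term Ti (T s) t0 sums (s - Ti t0)"
  using taylor_sums[OF holomorphic_on_subset[OF Ti_holo assms(2)] assms(3)] Ti_T[OF assms(1)]
  by (simp add: taylor_term_def[abs_def])

text \<open>In each of the four cases the series for \<open>half_V\<close> is a combination of the Taylor series of
  \<open>Ti\<close>, and in the last one of its primitive \<open>N\<close>, at \<open>T s\<close>, evaluated at \<open>t0\<close>.\<close>

lemma half_V_coeff2:
  assumes "s \<in> X" "ball (T s) r \<subseteq> Y" "t0 \<in> ball (T s) r"
  shows "half_V coeff2 T s t s0 t0 = (s - s0) * (T s - t0) + (t - T s) * (s - Ti t0)"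
proof -
  have "coeff2 T (Suc j) s t s0 * (T s - t0) ^ Suc j / fact (Suc j) =
      (if j = 0 then (s - s0) * (T s - t0) else 0) + (t - T s) * taylor_term Ti (T s) t0 j" for j
    unfolding Dhat_taylor_term[OF assms(1), symmetric]
    by (simp add: coeff2_def algebra_simps add_divide_distrib diff_divide_distrib)
  then have "(\<lambda>j. coeff2 T (Suc j) s t s0 * (T s - t0) ^ Suc j / fact (Suc j))
      sums ((s - s0) * (T s - t0) + (t - T s) * (s - Ti t0))"
    by (simp only:) (intro sums_add sums_mult first_term_sums taylor_term_sums[OF assms])
  then show ?thesis
    unfolding half_V_def by (rule sums_unique[symmetric])
qed

lemma half_V_coeff4:
  assumes "s \<in> X" "ball (T s) r \<subseteq> Y" "t0 \<in> ball (T s) r"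
  shows "half_V coeff4 T s t s0 t0 = (s - s0) * (T s - t0) - (t - T s) * (s - Ti t0)"
proof -
  have "coeff4 T (Suc j) s t s0 * (T s - t0) ^ Suc j / fact (Suc j) =
      (if j = 0 then (s - s0) * (T s - t0) else 0) - (t - T s) * taylor_term Ti (T s) t0 j" for j
    unfolding Dhat_taylor_term[OF assms(1), symmetric]
    by (simp add: coeff4_def algebra_simps add_divide_distrib diff_divide_distrib)
  then have "(\<lambda>j. coeff4 T (Suc j) s t s0 * (T s - t0) ^ Suc j / fact (Suc j))
      sums ((s - s0) * (T s - t0) - (t - T s) * (s - Ti t0))"
    by (simp only:) (intro sums_diff sums_mult first_term_sums taylor_term_sums[OF assms])
  then show ?thesis
    unfolding half_V_def by (rule sums_unique[symmetric])
qed

lemma half_V_coeff3: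
  assumes "s \<in> X" "ball (T s) r \<subseteq> Y" "t0 \<in> ball (T s) r"
  shows "half_V coeff3 T s t s0 t0 =
    - (s - s0) * (T s - t0) + (t - T s) * (s - Ti t0) + 2 * (T s - t0) * (s - Ti t0)"
proof -
  have "coeff3 T (Suc j) s t s0 * (T s - t0) ^ Suc j / fact (Suc j) =
      (if j = 0 then - (s - s0) * (T s - t0) else 0) + (t - T s) * taylor_term Ti (T s) t0 j
      + (case j of 0 \<Rightarrow> 0 | Suc i \<Rightarrow> 2 * (T s - t0) * taylor_term Ti (T s) t0 i)" for j
  proof (cases j)
    case (Suc i)
    define F where "F = (fact (Suc i) :: complex)"
    have F: "fact (Suc (Suc i)) = of_nat (Suc (Suc i)) * F" "F \<noteq> 0"
      unfolding F_def by (rule fact_Suc fact_nonzero)+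
    have nz: "(of_nat (Suc (Suc i)) :: complex) \<noteq> 0" by (metis of_nat_eq_0_iff nat.distinct(2))
    show ?thesis
      using nz F(2) deriv_inverse(1)[OF assms(1)]
      unfolding Dhat_taylor_term[OF assms(1), symmetric] Suc coeff3_def nat.case F(1) F_def[symmetric]
      by (simp add: divide_simps del: of_nat_Suc Dhat.simps) (simp add: algebra_simps del: of_nat_Suc Dhat.simps)
  qed (simp add: coeff3_def algebra_simps add_divide_distrib diff_divide_distrib
        flip: Dhat_taylor_term[OF assms(1)])
  then have "(\<lambda>j. coeff3 T (Suc j) s t s0 * (T s - t0) ^ Suc j / fact (Suc j))
      sums (- (s - s0) * (T s - t0) + (t - T s) * (s - Ti t0) + 2 * (T s - t0) * (s - Ti t0))"
    by (simp only:) (intro sums_add sums_mult first_term_sums shifted_sums taylor_term_sums[OF assms])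
  then show ?thesis
    unfolding half_V_def by (rule sums_unique[symmetric])
qed

lemma half_V_coeff5:
  assumes "s \<in> X" "ball (T s) r \<subseteq> Y" "t0 \<in> ball (T s) r"
    and N: "\<And>w. w \<in> Y \<Longrightarrow> (N has_field_derivative Ti w) (at w)"
  shows "half_V coeff5 T s t s0 t0 =
    - (s - s0) * (T s - t0) - (t - T s) * (s - Ti t0) - 2 * (T s - t0) * (s - Ti t0)
    - 4 * (N (T s) - N t0 - s * (T s - t0))"
proof -
  have "deriv N w = Ti w" if "w \<in> Y" for w
    using N[OF that] by (rule DERIV_imp_deriv)
  then have "(deriv ^^ k) (deriv N) (T s) = (deriv ^^ k) Ti (T s)" for k
    using eventually_nhds_in_open[OF open_Y T_in_Y[OF assms(1)]]
    by (intro higher_deriv_cong_ev) (auto elim!: eventually_mono)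
  then have derivN: "(deriv ^^ Suc k) N (T s) = (deriv ^^ k) Ti (T s)" for k
    by (simp add: funpow_Suc_right del: funpow.simps)
  have "N holomorphic_on Y"
    using N open_Y holomorphic_on_open by blast
  then have "N holomorphic_on ball (T s) r"
    using assms(2) by (rule holomorphic_on_subset)
  then have N_sums: "taylor_term N (T s) t0 sums (N (T s) - N t0)"
    using taylor_sums assms(3) by (simp add: taylor_term_def[abs_def])
  have "coeff5 T (Suc j) s t s0 * (T s - t0) ^ Suc j / fact (Suc j) =
      (if j = 0 then - (s - s0) * (T s - t0) else 0) - (t - T s) * taylor_term Ti (T s) t0 j
      - (case j of 0 \<Rightarrow> 0 | Suc i \<Rightarrow> 2 * (T s - t0) * taylor_term Ti (T s) t0 i)
      - 4 * (taylor_term N (T s) t0 j - (if j = 0 then s * (T s - t0) else 0))" for j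
  proof (cases j)
    case 0
    have "taylor_term N (T s) t0 0 = s * (T s - t0)"
      using derivN[of 0] Ti_T[OF assms(1)] by (simp add: taylor_term_def)
    with 0 show ?thesis
      by (simp add: coeff5_def algebra_simps add_divide_distrib diff_divide_distrib
        flip: Dhat_taylor_term[OF assms(1)])
  next
    case (Suc i)
    define F where "F = (fact (Suc i) :: complex)"
    have F: "fact (Suc (Suc i)) = of_nat (Suc (Suc i)) * F" "F \<noteq> 0"
      unfolding F_def by (rule fact_Suc fact_nonzero)+
    have nz: "(of_nat (Suc (Suc i)) :: complex) \<noteq> 0" by (metis of_nat_eq_0_iff nat.distinct(2))
    have tN: "taylor_term N (T s) t0 (Suc i) =
        (-1) ^ Suc i * (1 / deriv T s * Dhat T i s) * (T s - t0) ^ Suc (Suc i) / fact (Suc (Suc i))"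
      unfolding taylor_term_def derivN Dhat_eq_higher_deriv[OF assms(1)] ..
    show ?thesis
      using nz F(2) deriv_inverse(1)[OF assms(1)]
      unfolding Dhat_taylor_term[OF assms(1), symmetric] Suc tN coeff5_def nat.case F(1) F_def[symmetric]
      by (simp add: divide_simps del: of_nat_Suc Dhat.simps) (simp add: algebra_simps del: of_nat_Suc Dhat.simps)
  qed
  then have "(\<lambda>j. coeff5 T (Suc j) s t s0 * (T s - t0) ^ Suc j / fact (Suc j))
      sums (- (s - s0) * (T s - t0) - (t - T s) * (s - Ti t0) - 2 * (T s - t0) * (s - Ti t0)
        - 4 * (N (T s) - N t0 - s * (T s - t0)))"
    by (simp only:) (intro sums_diff sums_mult first_term_sums shifted_sums taylor_term_sums[OF assms(1-3)] N_sums)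
  then show ?thesis
    unfolding half_V_def by (rule sums_unique[symmetric])
qed

end

section \<open>Evaluation of the integral term\<close>

lemma dx_of_real_cong:
  assumes "open U" "z \<in> U" "\<And>w. w \<in> U \<Longrightarrow> g w = complex_of_real (h w)" "h differentiable (at z)"
  shows "dx g z = of_real (dx h z)"
  using dx_cong[OF assms(1-3)] dx_of_real[OF assms(4)] by simp

lemma dy_of_real_cong:
  assumes "open U" "z \<in> U" "\<And>w. w \<in> U \<Longrightarrow> g w = complex_of_real (h w)" "h differentiable (at z)"
  shows "dy g z = of_real (dy h z)"
  using dy_cong[OF assms(1-3)] dy_of_real[OF assms(4)] by simp

lemma laplacian_of_real:
  assumes "open U" "z \<in> U" and diff: "\<And>w. w \<in> U \<Longrightarrow> h differentiable (at w)"
    "\<And>w. w \<in> U \<Longrightarrow> dx h differentiable (at w)" "\<And>w. w \<in> U \<Longrightarrow> dy h differentiable (at w)"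
  shows "laplacian (\<lambda>w. complex_of_real (h w)) z = of_real (laplacian h z)"
  unfolding laplacian_def
  using dx_of_real_cong[OF assms(1,2), of "dx (\<lambda>w. complex_of_real (h w))" "dx h"]
    dy_of_real_cong[OF assms(1,2), of "dy (\<lambda>w. complex_of_real (h w))" "dy h"]
    dx_of_real[OF diff(1)] dy_of_real[OF diff(1)] diff(2,3) assms(2) by simp

lemma Re_holomorphic_partials:
  assumes "open U" "z \<in> U" "F holomorphic_on U" "\<And>w. w \<in> U \<Longrightarrow> g w = of_real (8 * Re (F w))"
  shows "dx g z = complex_of_real (8 * Re (deriv F z))" "dy g z = complex_of_real (- 8 * Im (deriv F z))"
proof -
  have "(F has_derivative (*) (deriv F z)) (at z)"
    using holomorphic_derivI[OF assms(3,1,2)] by (simp add: has_field_derivative_def)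
  then have "((\<lambda>w. complex_of_real (8 * Re (F w))) has_derivative (\<lambda>v. of_real (8 * Re (deriv F z * v)))) (at z)"
    by (intro derivative_intros)
  then have "(g has_derivative (\<lambda>v. complex_of_real (8 * Re (deriv F z * v)))) (at z)"
    by (rule has_derivative_transform_within_open[OF _ assms(1,2)]) (simp add: assms(4))
  from dx_eqI[OF this] dy_eqI[OF this]
  show "dx g z = complex_of_real (8 * Re (deriv F z))" "dy g z = complex_of_real (- 8 * Im (deriv F z))"
    by simp_all
qed

lemma diff_cnj_partials:
  assumes "open U" "z \<in> U" "F holomorphic_on U" "\<And>w. w \<in> U \<Longrightarrow> V w = F w - cnj (F w)"
  shows "dx V z = deriv F z - cnj (deriv F z)" "dy V z = \<i> * deriv F z - cnj (\<i> * deriv F z)"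
proof -
  have "(F has_derivative (*) (deriv F z)) (at z)"
    using holomorphic_derivI[OF assms(3,1,2)] by (simp add: has_field_derivative_def)
  then have "((\<lambda>w. F w - cnj (F w)) has_derivative (\<lambda>v. deriv F z * v - cnj (deriv F z * v))) (at z)"
    by (intro derivative_intros)
  then have "(V has_derivative (\<lambda>v. deriv F z * v - cnj (deriv F z * v))) (at z)"
    by (rule has_derivative_transform_within_open[OF _ assms(1,2)]) (simp add: assms(4))
  from dx_eqI[OF this] dy_eqI[OF this]
  show "dx V z = deriv F z - cnj (deriv F z)" "dy V z = \<i> * deriv F z - cnj (\<i> * deriv F z)"
    by (simp_all add: mult.commute)
qed

lemma diff_cnj_laplacian:
  assumes "open U" "z \<in> U" "F holomorphic_on U" "\<And>w. w \<in> U \<Longrightarrow> V w = F w - cnj (F w)"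
  shows "laplacian V z = 0"
proof -
  note hol = holomorphic_deriv[OF assms(3,1)]
  have "dx (dx V) z = deriv (deriv F) z - cnj (deriv (deriv F) z)"
    by (rule diff_cnj_partials[OF assms(1,2) hol]) (use diff_cnj_partials[OF assms(1) _ assms(3,4)] in auto)
  moreover have "dy (dy V) z = \<i> * deriv (\<lambda>z. \<i> * deriv F z) z - cnj (\<i> * deriv (\<lambda>z. \<i> * deriv F z) z)"
    by (rule diff_cnj_partials[OF assms(1,2)])
       (use diff_cnj_partials[OF assms(1) _ assms(3,4)] in \<open>auto intro!: holomorphic_intros hol\<close>)
  moreover have "deriv (\<lambda>z. \<i> * deriv F z) z = \<i> * deriv (deriv F) z"
    by (rule DERIV_imp_deriv) (rule DERIV_cmult[OF holomorphic_derivI[OF hol assms(1,2)]])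
  ultimately show ?thesis
    by (simp add: laplacian_def)
qed

text \<open>For \<open>V = a - cnj a\<close> and \<open>u = 2 Re (cnj z A + B)\<close> the form under the integral is exact. Up to
  factors, \<open>Im a\<close> is \<open>V\<close> and \<open>Im A'\<close> is the harmonic conjugate of \<open>\<Delta>u\<close>, so that \<open>Im a Im A'\<close> comes from an
  integration by parts; what remains is a multiple of the real part of \<open>A' a' dz\<close>.\<close>

theorem K_term_eq:
  assumes U: "open U" and hol: "A holomorphic_on U" "B holomorphic_on U" "a holomorphic_on U"
    and u: "\<And>z. z \<in> U \<Longrightarrow> u z = 2 * Re (cnj z * A z + B z)"
    and V: "\<And>z. z \<in> U \<Longrightarrow> V z = a z - cnj (a z)"
    and E: "\<And>z. z \<in> U \<Longrightarrow> (E has_field_derivative deriv A z * deriv a z) (at z)"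
    and \<gamma>: "joins_in U G Q \<gamma>"
  defines "\<Phi> \<equiv> \<lambda>z. - 2 * (Im (a z) * Im (deriv A z) + Re (E z))"
  shows "K_term V (\<lambda>q. complex_of_real (u q)) \<gamma> = of_real (\<Phi> Q - \<Phi> (\<gamma> 0))"
proof -
  let ?u = "\<lambda>q. complex_of_real (u q)"
  define X where "X q = V q * dy (laplacian ?u) q - laplacian ?u q * dy V q
         + laplacian V q * dy ?u q - ?u q * dy (laplacian V) q" for q
  define Y where "Y q = - (V q * dx (laplacian ?u) q - laplacian ?u q * dx V q
         + laplacian V q * dx ?u q - ?u q * dx (laplacian V) q)" for q
  define \<Phi>' where "\<Phi>' z v = - 2 * (Im (deriv a z * v) * Im (deriv A z) + Im (a z) * Im (deriv (deriv A) z * v)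
      + Re (deriv A z * deriv a z * v))" for z v
  have \<Phi>': "(\<Phi> has_derivative \<Phi>' z) (at z)" if z: "z \<in> U" for z
  proof -
    have "(a has_derivative (*) (deriv a z)) (at z)" "(deriv A has_derivative (*) (deriv (deriv A) z)) (at z)"
      "(E has_derivative (*) (deriv A z * deriv a z)) (at z)"
      using holomorphic_derivI[OF hol(3) U z] holomorphic_derivI[OF holomorphic_deriv[OF hol(1) U] U z] E[OF z]
      by (simp_all add: has_field_derivative_def)
    then show ?thesis
      unfolding \<Phi>_def \<Phi>'_def
      by (auto intro!: derivative_eq_intros simp: algebra_simps fun_eq_iff)
  qed
  have form: "X z * of_real (Re v) + Y z * of_real (Im v) = 8 * \<i> * of_real (\<Phi>' z v)"
    if z: "z \<in> U" for z v
  proof -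
    note pd = goursat_partials_differentiable[OF U _ hol(1,2) u]
    have lap: "laplacian ?u w = of_real (8 * Re (deriv A w))" if "w \<in> U" for w
      using laplacian_of_real[OF U that pd] goursat_laplacian[OF U that hol(1,2) u] by simp
    have lapV: "laplacian V w = 0" if "w \<in> U" for w
      by (rule diff_cnj_laplacian[OF U that hol(3) V])
    have "dx (laplacian V) z = dx (\<lambda>_. 0 :: complex) z" "dy (laplacian V) z = dy (\<lambda>_. 0 :: complex) z"
      using dx_cong[OF U z lapV] dy_cong[OF U z lapV] by auto
    then have d0: "dx (laplacian V) z = 0" "dy (laplacian V) z = 0"
      by (simp_all add: dx_def dy_def)
    have "dx (laplacian ?u) z = of_real (8 * Re (deriv (deriv A) z))"
      "dy (laplacian ?u) z = of_real (- 8 * Im (deriv (deriv A) z))"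
      by (rule Re_holomorphic_partials[OF U z holomorphic_deriv[OF hol(1) U] lap]; assumption)+
    moreover have "dx V z = deriv a z - cnj (deriv a z)" "dy V z = \<i> * deriv a z - cnj (\<i> * deriv a z)"
      by (rule diff_cnj_partials[OF U z hol(3) V]; assumption)+
    ultimately show ?thesis
      unfolding X_def Y_def \<Phi>'_def d0 lapV[OF z] V[OF z] lap[OF z]
      by (simp add: complex_eq_iff algebra_simps)
  qed
  have \<gamma>: "valid_path \<gamma>" "path_image \<gamma> \<subseteq> U" "\<gamma> 1 = Q"
    using \<gamma> by (auto simp: joins_in_def pathfinish_def)
  then have "continuous_on {0..1} \<gamma>" and "\<exists>k. finite k \<and> \<gamma> C1_differentiable_on {0..1} - k"
    by (auto simp: valid_path_def piecewise_C1_differentiable_on_def)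
  then obtain k where k: "finite k" "\<gamma> C1_differentiable_on {0..1} - k" by blast
  have in_U: "\<gamma> t \<in> U" if "t \<in> {0..1}" for t
    using \<gamma>(2) that by (auto simp: path_image_def)
  have "((\<lambda>t. X (\<gamma> t) * of_real (Re (vector_derivative \<gamma> (at t within {0..1}))) +
      Y (\<gamma> t) * of_real (Im (vector_derivative \<gamma> (at t within {0..1})))) has_integral
      8 * \<i> * of_real (\<Phi> (\<gamma> 1)) - 8 * \<i> * of_real (\<Phi> (\<gamma> 0))) {0..1}"
  proof (rule fundamental_theorem_of_calculus_interior_strong[OF k(1), of 0 1 "\<lambda>t. 8 * \<i> * of_real (\<Phi> (\<gamma> t))"])
    fix t :: real assume t: "t \<in> {0<..<1} - k"
    then have t01: "t \<in> {0..1}" by auto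
    have "\<gamma> differentiable (at t)"
      using k(2) t by (auto simp: C1_differentiable_on_eq)
    then have der: "(\<gamma> has_derivative (\<lambda>h. h *\<^sub>R vector_derivative \<gamma> (at t))) (at t)"
      by (simp add: vector_derivative_works has_vector_derivative_def)
    have vd: "vector_derivative \<gamma> (at t within {0..1}) = vector_derivative \<gamma> (at t)"
      using t by (intro vector_derivative_at_within_ivl[where a=0 and b=1])
        (auto simp: vector_derivative_works[symmetric] \<open>\<gamma> differentiable (at t)\<close>)
    interpret bounded_linear "\<Phi>' (\<gamma> t)"
      by (rule has_derivative_bounded_linear[OF \<Phi>'[OF in_U[OF t01]]])
    have "(\<Phi> \<circ> \<gamma> has_derivative \<Phi>' (\<gamma> t) \<circ> (\<lambda>h. h *\<^sub>R vector_derivative \<gamma> (at t))) (at t)"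
      by (rule diff_chain_at[OF der \<Phi>'[OF in_U[OF t01]]])
    then have "((\<lambda>t. \<Phi> (\<gamma> t)) has_vector_derivative \<Phi>' (\<gamma> t) (vector_derivative \<gamma> (at t))) (at t)"
      by (simp add: has_vector_derivative_def o_def scaleR)
    then have "((\<lambda>t. 8 * \<i> * complex_of_real (\<Phi> (\<gamma> t))) has_vector_derivative
        8 * \<i> * of_real (\<Phi>' (\<gamma> t) (vector_derivative \<gamma> (at t)))) (at t)"
      by (intro has_vector_derivative_mult_right has_vector_derivative_of_real)
        (simp add: has_real_derivative_iff_has_vector_derivative)
    then show "((\<lambda>t. 8 * \<i> * complex_of_real (\<Phi> (\<gamma> t))) has_vector_derivative
        X (\<gamma> t) * of_real (Re (vector_derivative \<gamma> (at t within {0..1}))) +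
        Y (\<gamma> t) * of_real (Im (vector_derivative \<gamma> (at t within {0..1})))) (at t)"
      unfolding vd form[OF in_U[OF t01]] .
  next
    have "continuous_on U \<Phi>"
      using \<Phi>' by (meson continuous_at_imp_continuous_on has_derivative_continuous)
    then have "continuous_on {0..1} (\<lambda>t. \<Phi> (\<gamma> t))"
      by (rule continuous_on_compose2) (use \<open>continuous_on {0..1} \<gamma>\<close> in_U in auto)
    then show "continuous_on {0..1} (\<lambda>t. 8 * \<i> * complex_of_real (\<Phi> (\<gamma> t)))"
      by (intro continuous_intros)
  qed auto
  then have "line_integral X Y \<gamma> = 8 * \<i> * of_real (\<Phi> (\<gamma> 1)) - 8 * \<i> * of_real (\<Phi> (\<gamma> 0))"
    unfolding line_integral_def by (rule integral_unique)
  then have "K_term V ?u \<gamma> = 1 / (8 * \<i>) * (8 * \<i> * of_real (\<Phi> (\<gamma> 1)) - 8 * \<i> * of_real (\<Phi> (\<gamma> 0)))"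
    by (simp add: K_term_def X_def[abs_def] Y_def[abs_def])
  also have "\<dots> = of_real (\<Phi> Q - \<Phi> (\<gamma> 0))"
    using \<gamma>(3) by (simp add: field_simps)
  finally show ?thesis .
qed

section \<open>Continuation of the boundary conditions\<close>

text \<open>\<open>G\<close> is the curve and \<open>z \<mapsto> cnj (S z)\<close> the reflection. An identity between holomorphic
  functions on \<open>W\<close>, the part of \<open>U\<close> whose reflection lies in \<open>U\<close>, holds as soon as it holds on \<open>G\<close>.\<close>

locale reflected_domain =
  fixes S :: "complex \<Rightarrow> complex" and U G :: "complex set"
  assumes open_U: "open U" and simply_connected_U: "simply_connected U" and S_holo: "S holomorphic_on U"
    and conn_W: "connected {z\<in>U. cnj (S z) \<in> U}"
    and G_sub: "G \<subseteq> U" and S_G: "\<And>z. z \<in> G \<Longrightarrow> S z = cnj z"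
    and G_limpt: "\<And>z. z \<in> G \<Longrightarrow> z islimpt G" and G_nonempty: "G \<noteq> {}"
begin

definition "W = {z\<in>U. cnj (S z) \<in> U}"

lemma W_sub: "W \<subseteq> U" by (auto simp: W_def)

lemma G_sub_W: "G \<subseteq> W"
  using G_sub S_G by (auto simp: W_def)

lemma open_W: "open W"
proof -
  have "continuous_on U (\<lambda>z. cnj (S z))"
    by (intro continuous_intros holomorphic_on_imp_continuous_on S_holo)
  then have "open (U \<inter> (\<lambda>z. cnj (S z)) -` U)"
    using open_U by (simp add: continuous_on_open_vimage Int_commute)
  then show ?thesis
    by (simp add: W_def vimage_def Int_def)
qed

lemma connected_W: "connected W" using conn_W by (simp add: W_def)

lemma vanish_on_W:
  assumes "F holomorphic_on W" "\<And>z. z \<in> G \<Longrightarrow> F z = 0" "z \<in> W"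
  shows "F z = 0"
proof -
  obtain q where "q \<in> G" using G_nonempty by blast
  then show ?thesis
    using analytic_continuation[OF assms(1) open_W connected_W G_sub_W _ G_limpt assms(2,3)] G_sub_W by blast
qed

lemma S_deriv:
  assumes "z \<in> W"
  shows "(S has_field_derivative deriv S z) (at z)"
  using assms holomorphic_derivI[OF S_holo open_U] W_sub by blast

lemma reflect_deriv:
  assumes "F holomorphic_on U" "z \<in> W"
  shows "((\<lambda>z. cnj (F (cnj (S z)))) has_field_derivative cnj (deriv F (cnj (S z))) * deriv S z) (at z)"
proof -
  have "(F has_field_derivative deriv F (cnj (S z))) (at (cnj (S z)))"
    using assms holomorphic_derivI[OF _ open_U] by (auto simp: W_def)
  then have "((cnj \<circ> F \<circ> cnj) has_field_derivative cnj (deriv F (cnj (S z)))) (at (S z))"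
    using has_field_derivative_cnj_cnj[of F _ "S z"] by simp
  from DERIV_chain2[OF this S_deriv[OF assms(2)]] show ?thesis
    by (simp add: o_def)
qed

lemma reflect_holo:
  assumes "F holomorphic_on U"
  shows "(\<lambda>z. cnj (F (cnj (S z)))) holomorphic_on W"
  using reflect_deriv[OF assms] open_W holomorphic_on_open by blast

lemma W_deriv:
  assumes "F holomorphic_on U" "z \<in> W"
  shows "(F has_field_derivative deriv F z) (at z)"
  using assms holomorphic_derivI[OF _ open_U] W_sub by blast

lemmas W_holo = holomorphic_on_subset[OF _ W_sub]
lemmas deriv_holo = holomorphic_deriv[OF _ open_U]

context
  fixes A B :: "complex \<Rightarrow> complex" and u :: "complex \<Rightarrow> real"
  assumes A: "A holomorphic_on U" and B: "B holomorphic_on U"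
    and u: "\<And>z. z \<in> U \<Longrightarrow> u z = 2 * Re (cnj z * A z + B z)"
begin

lemma dirichlet_on_W:
  assumes "\<And>q. q \<in> G \<Longrightarrow> u q = 0" "z \<in> W"
  shows "S z * A z + B z + z * cnj (A (cnj (S z))) + cnj (B (cnj (S z))) = 0"
proof (rule vanish_on_W[OF _ _ assms(2)])
  show "(\<lambda>z. S z * A z + B z + z * cnj (A (cnj (S z))) + cnj (B (cnj (S z)))) holomorphic_on W"
    by (intro holomorphic_intros reflect_holo A B W_holo S_holo)
  show "S q * A q + B q + q * cnj (A (cnj (S q))) + cnj (B (cnj (S q))) = 0" if "q \<in> G" for q
    using assms(1)[OF that] u[of q] subsetD[OF G_sub that]
    unfolding S_G[OF that] complex_cnj_cnj by (simp add: complex_eq_iff algebra_simps)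
qed

lemma laplacian_zero_on_W:
  assumes "\<And>q. q \<in> G \<Longrightarrow> laplacian u q = 0" "z \<in> W"
  shows "cnj (deriv A (cnj (S z))) = - deriv A z"
proof -
  have "deriv A z + cnj (deriv A (cnj (S z))) = 0"
  proof (rule vanish_on_W[OF _ _ assms(2)])
    show "(\<lambda>z. deriv A z + cnj (deriv A (cnj (S z)))) holomorphic_on W"
      by (intro holomorphic_intros reflect_holo W_holo deriv_holo A)
    show "deriv A q + cnj (deriv A (cnj (S q))) = 0" if "q \<in> G" for q
    proof -
      have "laplacian u q = 8 * Re (deriv A q)"
        using goursat_laplacian[OF open_U _ A B u] that G_sub by blast
      then show ?thesis
        using assms(1)[OF that] unfolding S_G[OF that] complex_cnj_cnj by (simp add: complex_eq_iff)
    qed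
  qed
  then show ?thesis by (simp add: add_eq_0_iff)
qed

lemma wirtinger_derivative:
  assumes "z \<in> U"
  shows "of_real (dx u z) - \<i> * of_real (dy u z) = 2 * (cnj z * deriv A z + deriv B z + cnj (A z))"
    "of_real (dx u z) + \<i> * of_real (dy u z) = 2 * (A z + z * cnj (deriv A z) + cnj (deriv B z))"
  using goursat_dx[OF open_U assms A B u] goursat_dy[OF open_U assms A B u]
  by (simp_all add: complex_eq_iff algebra_simps)

text \<open>The condition on \<open>G\<close> is \<open>\<partial>\<^sub>n u = 0\<close> in the form given by \<open>normal_deriv_zero_imp\<close>.\<close>

lemma neumann_on_W:
  assumes "\<And>q. q \<in> G \<Longrightarrow> of_real (dx u q) - \<i> * of_real (dy u q) = deriv S q * (of_real (dx u q) + \<i> * of_real (dy u q))"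
    and "z \<in> W"
  shows "S z * deriv A z + deriv B z + cnj (A (cnj (S z))) =
    deriv S z * (A z + z * cnj (deriv A (cnj (S z))) + cnj (deriv B (cnj (S z))))"
proof -
  have "S z * deriv A z + deriv B z + cnj (A (cnj (S z))) -
      deriv S z * (A z + z * cnj (deriv A (cnj (S z))) + cnj (deriv B (cnj (S z)))) = 0"
  proof (rule vanish_on_W[OF _ _ assms(2)])
    show "(\<lambda>z. S z * deriv A z + deriv B z + cnj (A (cnj (S z))) -
        deriv S z * (A z + z * cnj (deriv A (cnj (S z))) + cnj (deriv B (cnj (S z))))) holomorphic_on W"
      by (intro holomorphic_intros reflect_holo W_holo deriv_holo A B S_holo)
    show "S q * deriv A q + deriv B q + cnj (A (cnj (S q))) -
        deriv S q * (A q + q * cnj (deriv A (cnj (S q))) + cnj (deriv B (cnj (S q)))) = 0" if "q \<in> G" for q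
    proof -
      have "2 * (cnj q * deriv A q + deriv B q + cnj (A q)) =
          deriv S q * (2 * (A q + q * cnj (deriv A q) + cnj (deriv B q)))"
        using assms(1)[OF that] unfolding wirtinger_derivative[OF subsetD[OF G_sub that]] .
      also have "\<dots> = 2 * (deriv S q * (A q + q * cnj (deriv A q) + cnj (deriv B q)))"
        by (rule mult.left_commute)
      finally have "cnj q * deriv A q + deriv B q + cnj (A q) =
          deriv S q * (A q + q * cnj (deriv A q) + cnj (deriv B q))"
        by (rule mult_left_cancel[THEN iffD1, rotated]) simp
      then show ?thesis
        unfolding S_G[OF that] complex_cnj_cnj by simp
    qed
  qed
  then show ?thesis by simp
qed

text \<open>If \<open>u\<close> and \<open>\<partial>\<^sub>n u\<close> vanish on the curve, so does the gradient: differentiating \<open>dirichlet_on_W\<close>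
  gives \<open>u\<^sub>z + S' u\<^sub>w = 0\<close>, while the normal derivative gives \<open>u\<^sub>z - S' u\<^sub>w = 0\<close>.\<close>

lemma cauchy_on_W:
  assumes u0: "\<And>q. q \<in> G \<Longrightarrow> u q = 0"
    and neu: "\<And>q. q \<in> G \<Longrightarrow> of_real (dx u q) - \<i> * of_real (dy u q) = deriv S q * (of_real (dx u q) + \<i> * of_real (dy u q))"
    and "z \<in> W"
  shows "S z * deriv A z + deriv B z + cnj (A (cnj (S z))) = 0"
proof (rule vanish_on_W[OF _ _ assms(3)])
  show "(\<lambda>z. S z * deriv A z + deriv B z + cnj (A (cnj (S z)))) holomorphic_on W"
    by (intro holomorphic_intros reflect_holo W_holo deriv_holo A B S_holo)
  fix z assume "z \<in> G"
  then have z: "z \<in> W" using G_sub_W by blast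
  have "((\<lambda>z. S z * A z + B z + z * cnj (A (cnj (S z))) + cnj (B (cnj (S z)))) has_field_derivative
      (deriv S z * A z + deriv A z * S z + deriv B z + (1 * cnj (A (cnj (S z))) + cnj (deriv A (cnj (S z))) * deriv S z * z)
        + cnj (deriv B (cnj (S z))) * deriv S z)) (at z)"
    by (intro DERIV_add DERIV_mult DERIV_ident reflect_deriv W_deriv S_deriv A B z)
  moreover have "((\<lambda>z. S z * A z + B z + z * cnj (A (cnj (S z))) + cnj (B (cnj (S z)))) has_field_derivative 0) (at z)"
    by (rule DERIV_cong_ev[THEN iffD2, OF refl _ refl DERIV_const[of 0]])
       (use eventually_nhds_in_open[OF open_W z] dirichlet_on_W[OF u0] in \<open>auto elim!: eventually_mono\<close>)
  ultimately have "deriv S z * A z + deriv A z * S z + deriv B z + (1 * cnj (A (cnj (S z))) + cnj (deriv A (cnj (S z))) * deriv S z * z)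
        + cnj (deriv B (cnj (S z))) * deriv S z = 0"
    by (rule DERIV_unique)
  moreover define X Y where "X = S z * deriv A z + deriv B z + cnj (A (cnj (S z)))"
    and "Y = deriv S z * (A z + z * cnj (deriv A (cnj (S z))) + cnj (deriv B (cnj (S z))))"
  ultimately have "X + Y = 0" by (simp add: algebra_simps)
  moreover have "X = Y" using neumann_on_W[OF neu z] by (simp add: X_def Y_def)
  ultimately show "S z * deriv A z + deriv B z + cnj (A (cnj (S z))) = 0"
    by (simp add: X_def flip: mult_2)
qed

text \<open>If \<open>\<partial>\<^sub>n \<Delta>u\<close> vanishes on the curve, then \<open>Im A'\<close>, essentially the harmonic conjugate of \<open>\<Delta>u\<close>, is
  constant there. Adding \<open>\<i> \<lambda> z\<close> with real \<open>\<lambda>\<close> to \<open>A\<close> does not change \<open>u\<close>, and \<open>\<lambda>\<close> can be chosen so as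
  to make the constant \<open>0\<close>.\<close>

lemma normalized_goursat:
  assumes neu: "\<And>q. q \<in> G \<Longrightarrow> of_real (dx (laplacian u) q) - \<i> * of_real (dy (laplacian u) q)
      = deriv S q * (of_real (dx (laplacian u) q) + \<i> * of_real (dy (laplacian u) q))"
  obtains A1 where "A1 holomorphic_on U" "\<And>z. z \<in> U \<Longrightarrow> u z = 2 * Re (cnj z * A1 z + B z)"
    "\<And>z. z \<in> W \<Longrightarrow> cnj (deriv A1 (cnj (S z))) = deriv A1 z"
proof -
  let ?A' = "deriv A" and ?A'' = "deriv (deriv A)"
  have grad: "dx (laplacian u) q = 8 * Re (?A'' q)" "dy (laplacian u) q = - 8 * Im (?A'' q)" if "q \<in> U" for q
  proof -
    have lap: "laplacian u z = 2 * Re (cnj z * 0 + 4 * ?A' z)" if "z \<in> U" for z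
      using goursat_laplacian[OF open_U that A B u] by simp
    have "deriv (\<lambda>z. 4 * ?A' z) q = 4 * ?A'' q"
      by (intro DERIV_imp_deriv DERIV_cmult holomorphic_derivI[OF deriv_holo[OF A] open_U that])
    moreover have "(\<lambda>z. 4 * ?A' z) holomorphic_on U"
      by (intro holomorphic_intros deriv_holo A)
    ultimately show "dx (laplacian u) q = 8 * Re (?A'' q)" "dy (laplacian u) q = - 8 * Im (?A'' q)"
      using goursat_dx[OF open_U that holomorphic_on_const _ lap] goursat_dy[OF open_U that holomorphic_on_const _ lap]
      by simp_all
  qed
  have "?A'' z - deriv S z * cnj (?A'' (cnj (S z))) = 0" if "z \<in> W" for z
  proof (rule vanish_on_W[OF _ _ that])
    show "(\<lambda>z. ?A'' z - deriv S z * cnj (?A'' (cnj (S z)))) holomorphic_on W"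
      by (intro holomorphic_intros reflect_holo W_holo deriv_holo A S_holo)
    fix q assume q: "q \<in> G"
    then have "q \<in> U" using G_sub by blast
    have "8 * ?A'' q = deriv S q * (8 * cnj (?A'' q))"
      using neu[OF q] unfolding grad[OF \<open>q \<in> U\<close>] by (simp add: complex_eq_iff algebra_simps)
    then show "?A'' q - deriv S q * cnj (?A'' (cnj (S q))) = 0"
      using S_G[OF q] by simp
  qed
  then have "((\<lambda>z. ?A' z - cnj (?A' (cnj (S z)))) has_field_derivative 0) (at z)" if "z \<in> W" for z
    using DERIV_diff[OF W_deriv[OF deriv_holo[OF A] that] reflect_deriv[OF deriv_holo[OF A] that]] that
    by (simp add: mult.commute)
  then have "(\<lambda>z. ?A' z - cnj (?A' (cnj (S z)))) constant_on W"
    by (rule has_field_derivative_0_imp_constant_on[OF _ connected_W open_W])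
  then obtain \<kappa> where \<kappa>: "\<And>z. z \<in> W \<Longrightarrow> ?A' z - cnj (?A' (cnj (S z))) = \<kappa>"
    unfolding constant_on_def by blast
  obtain q where q: "q \<in> G" using G_nonempty by blast
  have Re_\<kappa>: "Re \<kappa> = 0"
    using \<kappa>[OF subsetD[OF G_sub_W q]] unfolding S_G[OF q] complex_cnj_cnj by auto
  define A1 where "A1 z = A z - \<kappa> / 2 * z" for z
  have holA1: "A1 holomorphic_on U"
    unfolding A1_def by (intro holomorphic_intros A) auto
  moreover have "u z = 2 * Re (cnj z * A1 z + B z)" if "z \<in> U" for z
    using u[OF that] Re_\<kappa> by (simp add: A1_def algebra_simps)
  moreover have "cnj (deriv A1 (cnj (S z))) = deriv A1 z" if "z \<in> W" for z
  proof -
    have d: "deriv A1 z = ?A' z - \<kappa> / 2" if "z \<in> U" for z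
      unfolding A1_def
      by (rule DERIV_imp_deriv) (auto intro!: derivative_eq_intros holomorphic_derivI[OF A open_U that])
    have "z \<in> U" "cnj (S z) \<in> U" using that by (auto simp: W_def)
    then show ?thesis
      using \<kappa>[OF that] Re_\<kappa> by (simp add: d complex_eq_iff)
  qed
  ultimately show thesis by (rule that)
qed

section \<open>The reflection formulas\<close>

context
  fixes P Q :: complex
  assumes P: "P \<in> U" "cnj (S P) = Q" and Q: "Q \<in> U" "cnj (S Q) = P"
begin

lemma reflected_points: "P \<in> W" "Q \<in> W" "S P = cnj Q" "S Q = cnj P"
  using P Q by (auto simp: W_def) (metis complex_cnj_cnj)+

lemma primitive_difference:
  assumes E: "\<And>z. z \<in> U \<Longrightarrow> (E has_field_derivative e z) (at z)"
    and F: "\<And>z. z \<in> W \<Longrightarrow> (F has_field_derivative e z) (at z)" and "q \<in> W"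
  shows "E Q - E q = F Q - F q"
proof -
  have "((\<lambda>z. E z - F z) has_field_derivative 0) (at z)" if "z \<in> W" for z
    using DERIV_diff[OF E F[OF that]] W_sub that by auto
  then have "(\<lambda>z. E z - F z) constant_on W"
    by (rule has_field_derivative_0_imp_constant_on[OF _ connected_W open_W])
  then have "E Q - F Q = E q - F q"
    using reflected_points(2) assms(3) unfolding constant_on_def by metis
  then show ?thesis by (simp add: algebra_simps)
qed

text \<open>The Dirichlet identity at \<open>P\<close> leaves \<open>A P - A Q\<close> to be determined, which the vanishing of the
  continued gradient at \<open>Q\<close> expresses through derivatives of \<open>u\<close> at \<open>Q\<close>.\<close>

lemma cauchy_reflection:
  assumes u0: "\<And>q. q \<in> G \<Longrightarrow> u q = 0"
    and neu: "\<And>q. q \<in> G \<Longrightarrow> of_real (dx u q) - \<i> * of_real (dy u q) = deriv S q * (of_real (dx u q) + \<i> * of_real (dy u q))"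
  shows "u P = - u Q - Re (P - Q) * dx u Q - Im (P - Q) * dy u Q - (cmod (P - Q))\<^sup>2 / 4 * laplacian u Q"
proof -
  have d: "cnj Q * A P + B P + P * cnj (A Q) + cnj (B Q) = 0"
    using dirichlet_on_W[OF u0 reflected_points(1)] by (simp add: reflected_points)
  have "cnj P * deriv A Q + deriv B Q + cnj (A P) = 0"
    using cauchy_on_W[OF u0 neu reflected_points(2)] by (simp add: reflected_points)
  then have A_P: "cnj (A P) = - (cnj P * deriv A Q + deriv B Q)"
    by (simp add: add_eq_0_iff)
  have "u P + u Q = 2 * Re ((cnj P - cnj Q) * (A P - A Q))"
    using arg_cong[OF d, of Re] by (simp add: u P Q algebra_simps)
  also have "\<dots> = 2 * Re ((P - Q) * (cnj (A P) - cnj (A Q)))"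
    by (metis complex_cnj_diff complex_cnj_mult cnj.simps(1) complex_cnj_cnj)
  also have "\<dots> = - 2 * Re ((P - Q) * (cnj Q * deriv A Q + deriv B Q + cnj (A Q)))
      - 2 * Re ((P - Q) * cnj (P - Q) * deriv A Q)"
    unfolding A_P by (simp add: algebra_simps)
  finally have sum: "u P + u Q = - 2 * Re ((P - Q) * (cnj Q * deriv A Q + deriv B Q + cnj (A Q)))
      - 2 * Re ((P - Q) * cnj (P - Q) * deriv A Q)" .
  have "2 * Re ((P - Q) * (cnj Q * deriv A Q + deriv B Q + cnj (A Q)))
      = Re ((P - Q) * (of_real (dx u Q) - \<i> * of_real (dy u Q)))"
    unfolding wirtinger_derivative[OF Q(1)] by (simp add: algebra_simps)
  moreover have "2 * Re ((P - Q) * cnj (P - Q) * deriv A Q) = (cmod (P - Q))\<^sup>2 / 4 * laplacian u Q"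
    using goursat_laplacian[OF open_U Q(1) A B u] unfolding complex_norm_square[symmetric] by simp
  ultimately show ?thesis using sum by (simp add: algebra_simps)
qed

text \<open>In both integral formulas \<open>\<epsilon> = - 1\<close> belongs to \<open>\<Delta>u = 0\<close> and \<open>\<epsilon> = 1\<close> to \<open>\<partial>\<^sub>n \<Delta>u = 0\<close> on the curve, see
  \<open>laplacian_zero_on_W\<close> and \<open>normalized_goursat\<close>. The conditions on \<open>Im a\<close> make the term \<open>Im a Im A'\<close> of
  \<open>K_term_eq\<close> vanish at both ends of the path.\<close>

context
  fixes \<epsilon> :: complex and a V :: "complex \<Rightarrow> complex" and \<gamma> :: "real \<Rightarrow> complex"
  assumes eps: "\<And>z. z \<in> W \<Longrightarrow> cnj (deriv A (cnj (S z))) = \<epsilon> * deriv A z"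
    and a: "a holomorphic_on U" and V: "\<And>z. z \<in> U \<Longrightarrow> V z = a z - cnj (a z)"
    and a_Q: "Im (a Q) = 0" and a_G: "\<And>q. q \<in> G \<Longrightarrow> Im (a q) * Im (deriv A q) = 0"
    and \<gamma>: "joins_in U G Q \<gamma>"
begin

lemma reflect_A_deriv:
  assumes "z \<in> W"
  shows "((\<lambda>z. cnj (A (cnj (S z)))) has_field_derivative \<epsilon> * deriv A z * deriv S z) (at z)"
  using reflect_deriv[OF A assms] eps[OF assms] by simp

text \<open>A path from the curve to \<open>Q\<close> may leave \<open>W\<close>, but its ends lie there. Hence a primitive of \<open>A' a'\<close> on
  \<open>W\<close>, where the boundary conditions make it explicit, has the same increment as the one on \<open>U\<close>. It
  is imaginary on the curve, so the integral depends neither on the path nor on its starting point.\<close>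

lemma K_term_primitive_on_W:
  assumes F: "\<And>z. z \<in> W \<Longrightarrow> (F has_field_derivative deriv A z * deriv a z) (at z)"
    and F_G: "\<And>q. q \<in> G \<Longrightarrow> Re (F q) = 0"
  shows "K_term V (\<lambda>q. complex_of_real (u q)) \<gamma> = of_real (- 2 * Re (F Q))"
proof -
  have "(\<lambda>z. deriv A z * deriv a z) holomorphic_on U"
    by (intro holomorphic_intros deriv_holo A a)
  then obtain E where E: "\<And>z. z \<in> U \<Longrightarrow> (E has_field_derivative deriv A z * deriv a z) (at z)"
    using simply_connected_eq_global_primitive[OF open_U] simply_connected_U by blast
  have q: "\<gamma> 0 \<in> G" using \<gamma> by (simp add: joins_in_def pathstart_def)
  then have "E Q - E (\<gamma> 0) = F Q - F (\<gamma> 0)"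
    using primitive_difference[OF E F] G_sub_W by blast
  then have "Re (E Q) - Re (E (\<gamma> 0)) = Re (F Q)"
    using F_G[OF q] by (metis diff_zero minus_complex.sel(1))
  moreover have "K_term V (\<lambda>q. complex_of_real (u q)) \<gamma> =
      of_real (- 2 * (Im (a Q) * Im (deriv A Q) + Re (E Q))
        - - 2 * (Im (a (\<gamma> 0)) * Im (deriv A (\<gamma> 0)) + Re (E (\<gamma> 0))))"
    by (rule K_term_eq[OF open_U A B a u V E \<gamma>])
  ultimately show ?thesis
    unfolding a_Q a_G[OF q] by (simp add: algebra_simps flip: of_real_diff)
qed

text \<open>As \<open>\<epsilon> A' S'\<close> is the derivative of \<open>cnj (A (cnj (S z)))\<close>, the product \<open>A' a'\<close> has the primitive
  \<open>F\<close> below; at \<open>Q\<close> it involves the values of \<open>A\<close> at \<open>Q\<close> and at its reflection \<open>P\<close>.\<close>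

lemma dirichlet_reflection:
  assumes u0: "\<And>q. q \<in> G \<Longrightarrow> u q = 0"
    and a': "\<And>z. z \<in> W \<Longrightarrow> deriv a z = cnj (P - Q) - \<epsilon> * (P - Q) * deriv S z"
  shows "complex_of_real (u P) = - of_real (u Q) + K_term V (\<lambda>q. complex_of_real (u q)) \<gamma>"
proof -
  define F where "F z = cnj (P - Q) * A z - (P - Q) * cnj (A (cnj (S z)))" for z
  have "(F has_field_derivative deriv A z * deriv a z) (at z)" if z: "z \<in> W" for z
  proof -
    have "(F has_field_derivative cnj (P - Q) * deriv A z - (P - Q) * (\<epsilon> * deriv A z * deriv S z)) (at z)"
      unfolding F_def by (intro DERIV_diff DERIV_cmult W_deriv A reflect_A_deriv z)
    then show ?thesis by (simp add: a'[OF z] algebra_simps)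
  qed
  moreover have "Re (F q) = 0" if "q \<in> G" for q
    unfolding F_def S_G[OF that] by (simp add: algebra_simps)
  ultimately have K: "K_term V (\<lambda>q. complex_of_real (u q)) \<gamma> = of_real (- 2 * Re (F Q))"
    by (rule K_term_primitive_on_W)
  have d: "cnj Q * A P + B P + P * cnj (A Q) + cnj (B Q) = 0"
    using dirichlet_on_W[OF u0 reflected_points(1)] by (simp add: reflected_points)
  have sum: "u P + u Q = - 2 * Re (F Q)"
    using arg_cong[OF d, of Re] by (simp add: F_def u P Q reflected_points algebra_simps)
  show ?thesis unfolding K sum[symmetric] by simp
qed

text \<open>Write \<open>M z = cnj (A (cnj (S z)))\<close>, so that \<open>M' = \<epsilon> A' S'\<close>. The terms with \<open>P + Q\<close> are treated as above.
  The others contribute \<open>- 2 (S A' - z M')\<close>, and by \<open>neumann_on_W\<close> the bracket is half the derivative of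
  \<open>S A - z M - B + cnj (B (cnj (S z)))\<close>.\<close>

lemma neumann_reflection:
  assumes neu: "\<And>q. q \<in> G \<Longrightarrow> of_real (dx u q) - \<i> * of_real (dy u q) = deriv S q * (of_real (dx u q) + \<i> * of_real (dy u q))"
    and a': "\<And>z. z \<in> W \<Longrightarrow> deriv a z = 2 * \<epsilon> * z * deriv S z - 2 * S z - \<epsilon> * (P + Q) * deriv S z + cnj (P + Q)"
  shows "complex_of_real (u P) = of_real (u Q) + K_term V (\<lambda>q. complex_of_real (u q)) \<gamma>"
proof -
  define F where "F z = cnj (P + Q) * A z - (P + Q) * cnj (A (cnj (S z)))
    - (S z * A z - z * cnj (A (cnj (S z))) - B z + cnj (B (cnj (S z))))" for z
  have "(F has_field_derivative deriv A z * deriv a z) (at z)" if z: "z \<in> W" for z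
  proof -
    have "(F has_field_derivative cnj (P + Q) * deriv A z - (P + Q) * (\<epsilon> * deriv A z * deriv S z)
        - (deriv S z * A z + deriv A z * S z - (1 * cnj (A (cnj (S z))) + \<epsilon> * deriv A z * deriv S z * z)
            - deriv B z + cnj (deriv B (cnj (S z))) * deriv S z)) (at z)"
      unfolding F_def
      by (intro DERIV_diff DERIV_add DERIV_cmult DERIV_mult DERIV_ident W_deriv S_deriv A B
          reflect_A_deriv reflect_deriv z)
    moreover have "deriv S z * A z + cnj (deriv B (cnj (S z))) * deriv S z =
        S z * deriv A z + deriv B z + cnj (A (cnj (S z))) - deriv S z * z * (\<epsilon> * deriv A z)"
      using neumann_on_W[OF neu z] unfolding eps[OF z] by (simp add: algebra_simps)
    then have "cnj (P + Q) * deriv A z - (P + Q) * (\<epsilon> * deriv A z * deriv S z)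
        - (deriv S z * A z + deriv A z * S z - (1 * cnj (A (cnj (S z))) + \<epsilon> * deriv A z * deriv S z * z)
            - deriv B z + cnj (deriv B (cnj (S z))) * deriv S z) = deriv A z * deriv a z"
      unfolding a'[OF z] by (simp add: algebra_simps)
    ultimately show ?thesis by simp
  qed
  moreover have "Re (F q) = 0" if "q \<in> G" for q
    unfolding F_def S_G[OF that] by (simp add: algebra_simps)
  ultimately have K: "K_term V (\<lambda>q. complex_of_real (u q)) \<gamma> = of_real (- 2 * Re (F Q))"
    by (rule K_term_primitive_on_W)
  have diff: "u P - u Q = - 2 * Re (F Q)"
    by (simp add: F_def u P Q reflected_points algebra_simps)
  show ?thesis unfolding K diff[symmetric] by simp
qed

end
end
end
end

section \<open>The functions \<open>V\<close> near a point of the curve\<close>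

lemma dist_cnj: "dist (cnj a) (cnj b) = dist a b"
  by (metis complex_cnj_diff complex_mod_cnj dist_norm)

lemma cnj_ball: "cnj z \<in> ball (cnj p) e \<longleftrightarrow> z \<in> ball p e"
  by (simp add: dist_cnj)

text \<open>Both \<open>S\<close> and \<open>St\<close> are holomorphic on discs of radius \<open>r\<close>, about \<open>p\<close> and \<open>cnj p\<close>. Taking \<open>\<delta> \<le> r / 4\<close>,
  and small enough for \<open>S_near\<close>, makes the Taylor expansions below legitimate for all points within \<open>\<delta>\<close>
  of \<open>p\<close>.\<close>

locale schwarz_germ =
  fixes S St :: "complex \<Rightarrow> complex" and p :: complex and r \<delta> :: real
  assumes \<delta>: "0 < \<delta>" "\<delta> \<le> r / 4"
    and S_holo: "S holomorphic_on ball p r" and St_holo: "St holomorphic_on ball (cnj p) r"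
    and St_S: "\<And>z. z \<in> ball p r \<Longrightarrow> St (S z) = z" and S_St: "\<And>w. w \<in> ball (cnj p) r \<Longrightarrow> S (St w) = w"
    and St_eq: "\<And>w. w \<in> ball (cnj p) r \<Longrightarrow> St w = cnj (S (cnj w))"
    and S_near: "\<And>z. z \<in> ball p \<delta> \<Longrightarrow> S z \<in> ball (cnj p) (r / 4)"
begin

lemma ball_r: "z \<in> ball p \<delta> \<Longrightarrow> z \<in> ball p r"
  using \<delta> by auto

lemma St_cnj:
  assumes "z \<in> ball p \<delta>"
  shows "St (cnj z) = cnj (S z)"
  using St_eq[of "cnj z"] ball_r[OF assms] by (simp add: dist_cnj)

lemma S_in:
  assumes "z \<in> ball p \<delta>"
  shows "S z \<in> ball (cnj p) r" "cnj (S z) \<in> ball p r"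
proof -
  show *: "S z \<in> ball (cnj p) r"
    using S_near[OF assms] \<delta> by auto
  then show "cnj (S z) \<in> ball p r"
    using cnj_ball[of "cnj (S z)" p r] by simp
qed

lemma reflection_involution:
  assumes "z \<in> ball p \<delta>"
  shows "cnj (S (cnj (S z))) = z"
  using St_eq[OF S_in(1)[OF assms]] St_S[OF ball_r[OF assms]] by simp

lemma inverse_pair_S: "inverse_pair S St (ball p \<delta>) (ball (cnj p) r)"
  by standard (use S_holo St_holo S_in St_S ball_r in \<open>auto intro: holomorphic_on_subset\<close>)

lemma inverse_pair_St: "inverse_pair St S (ball (cnj p) \<delta>) (ball p r)"
proof
  fix w assume w: "w \<in> ball (cnj p) \<delta>"
  then have "cnj w \<in> ball p \<delta>" using cnj_ball[of "cnj w"] by simp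
  from St_cnj[OF this] S_in[OF this] show "St w \<in> ball p r" by simp
  show "S (St w) = w" using S_St[of w] w \<delta> by simp
next
  show "St holomorphic_on ball (cnj p) \<delta>"
    by (rule holomorphic_on_subset[OF St_holo]) (use \<delta> in auto)
qed (use S_holo in auto)

text \<open>The Taylor series involved converge: \<open>S z\<close> and \<open>cnj P\<close> lie within \<open>r / 4\<close> of \<open>cnj p\<close>, the centre of
  a disc of radius \<open>r\<close> on which \<open>St\<close> is holomorphic.\<close>

lemma taylor_discs:
  assumes "z \<in> ball p \<delta>" "P \<in> ball p \<delta>"
  shows "ball (S z) (r / 2) \<subseteq> ball (cnj p) r" "cnj P \<in> ball (S z) (r / 2)"
    "ball (St (cnj z)) (r / 2) \<subseteq> ball p r" "P \<in> ball (St (cnj z)) (r / 2)"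
proof -
  have 1: "dist (cnj p) (S z) < r / 4" using S_near[OF assms(1)] by simp
  have 2: "dist p P < r / 4" using assms(2) \<delta> by simp
  show A: "ball (S z) (r / 2) \<subseteq> ball (cnj p) r"
  proof
    fix y assume "y \<in> ball (S z) (r / 2)"
    then show "y \<in> ball (cnj p) r"
      using dist_triangle[of "cnj p" y "S z"] 1 \<delta> by simp
  qed
  show B: "cnj P \<in> ball (S z) (r / 2)"
    using dist_triangle[of "S z" "cnj P" "cnj p"] 1 2 dist_cnj[of p P] by (simp add: dist_commute)
  show "ball (St (cnj z)) (r / 2) \<subseteq> ball p r"
  proof
    fix y assume "y \<in> ball (St (cnj z)) (r / 2)"
    then have "cnj y \<in> ball (S z) (r / 2)"
      using dist_cnj[of "cnj (S z)" y] St_cnj[OF assms(1)] by simp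
    with A have "cnj y \<in> ball (cnj p) r" by blast
    then show "y \<in> ball p r" by (simp add: dist_cnj)
  qed
  show "P \<in> ball (St (cnj z)) (r / 2)"
    using B dist_cnj[of "cnj (S z)" P] St_cnj[OF assms(1)] by simp
qed

text \<open>Since \<open>St w = cnj (S (cnj w))\<close>, the two halves of \<open>V\<close> are complex conjugates. Each is the sum of a
  holomorphic function, an antiholomorphic one and \<open>\<plusminus> z cnj z\<close>, which is real and cancels, so that
  \<open>V = a - cnj a\<close> with a holomorphic \<open>a\<close>.\<close>

context
  fixes P Q z :: complex
  assumes P: "P \<in> ball p \<delta>" and Q: "Q = cnj (S P)" and z: "z \<in> ball p \<delta>"
begin

lemma V_fun_coeff2:
  defines "a \<equiv> \<lambda>z. cnj (P - Q) * z + (P - Q) * S z"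
  shows "V_fun coeff2 S St P z = a z - cnj (a z)"
proof -
  have cz: "cnj z \<in> ball (cnj p) \<delta>" using z by (simp add: dist_cnj)
  show ?thesis
    unfolding V_fun_def inverse_pair.half_V_coeff2[OF inverse_pair_S z taylor_discs(1,2)[OF z P]]
      inverse_pair.half_V_coeff2[OF inverse_pair_St cz taylor_discs(3,4)[OF z P]]
      St_cnj[OF z] St_cnj[OF P] a_def Q
    by (simp add: algebra_simps)
qed

lemma V_fun_coeff3:
  defines "a \<equiv> \<lambda>z. cnj (P - Q) * z - (P - Q) * S z + 2 * P * cnj Q"
  shows "V_fun coeff3 S St P z = a z - cnj (a z)"
proof -
  have cz: "cnj z \<in> ball (cnj p) \<delta>" using z by (simp add: dist_cnj)
  show ?thesis
    unfolding V_fun_def inverse_pair.half_V_coeff3[OF inverse_pair_S z taylor_discs(1,2)[OF z P]]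
      inverse_pair.half_V_coeff3[OF inverse_pair_St cz taylor_discs(3,4)[OF z P]]
      St_cnj[OF z] St_cnj[OF P] a_def Q
    by (simp add: algebra_simps)
qed

lemma V_fun_coeff4:
  defines "a \<equiv> \<lambda>z. cnj (P + Q) * z + (P + Q) * S z - 2 * z * S z"
  shows "V_fun coeff4 S St P z = a z - cnj (a z)"
proof -
  have cz: "cnj z \<in> ball (cnj p) \<delta>" using z by (simp add: dist_cnj)
  show ?thesis
    unfolding V_fun_def inverse_pair.half_V_coeff4[OF inverse_pair_S z taylor_discs(1,2)[OF z P]]
      inverse_pair.half_V_coeff4[OF inverse_pair_St cz taylor_discs(3,4)[OF z P]]
      St_cnj[OF z] St_cnj[OF P] a_def Q
    by (simp add: algebra_simps)
qed

lemma V_fun_coeff5: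
  assumes N: "\<And>z. z \<in> ball p r \<Longrightarrow> (N has_field_derivative S z) (at z)"
    and C: "\<And>z. z \<in> ball p \<delta> \<Longrightarrow> cnj (N (cnj (S z))) = z * S z - N z + C"
  defines "a \<equiv> \<lambda>z. 2 * z * S z - (P + Q) * S z + cnj (P + Q) * z - 4 * N z
      + (2 * cnj P * Q + 4 * C - 4 * cnj (N P))"
  shows "V_fun coeff5 S St P z = a z - cnj (a z)"
proof -
  have N': "((\<lambda>w. cnj (N (cnj w))) has_field_derivative St w) (at w)" if "w \<in> ball (cnj p) r" for w
    using has_field_derivative_cnj_cnj[OF N[of "cnj w"]] that cnj_ball[of "cnj w"] St_eq[OF that]
    by (simp add: o_def)
  have cz: "cnj z \<in> ball (cnj p) \<delta>" using z by (simp add: dist_cnj)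
  have C': "N (cnj (S z)) = cnj z * cnj (S z) - cnj (N z) + cnj C"
    using arg_cong[OF C[OF z], of cnj] by simp
  have 1: "half_V coeff5 S z (cnj z) P (cnj P) = - (z - P) * (S z - cnj P) - (cnj z - S z) * (z - Q)
      - 2 * (S z - cnj P) * (z - Q) - 4 * (z * S z - N z + C - cnj (N P) - z * (S z - cnj P))"
    using inverse_pair.half_V_coeff5[OF inverse_pair_S z taylor_discs(1,2)[OF z P] N', of "cnj z" P]
    unfolding St_cnj[OF P] Q complex_cnj_cnj C[OF z] by blast
  have 2: "half_V coeff5 St (cnj z) z (cnj P) P = - (cnj z - cnj P) * (cnj (S z) - P) - (z - cnj (S z)) * (cnj z - cnj Q)
      - 2 * (cnj (S z) - P) * (cnj z - cnj Q) - 4 * (N (cnj (S z)) - N P - cnj z * (cnj (S z) - P))"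
    using inverse_pair.half_V_coeff5[OF inverse_pair_St cz taylor_discs(3,4)[OF z P] N, of z "cnj P"]
    unfolding St_cnj[OF z] Q complex_cnj_cnj by blast
  show ?thesis
    unfolding V_fun_def 1 2 C' a_def by (simp add: algebra_simps)
qed

end

text \<open>\<open>N\<close> is a primitive of \<open>S\<close>, and \<open>w \<mapsto> cnj (N (cnj w))\<close> is one of \<open>St\<close>; the second equation is the
  formula for the integral of an inverse function.\<close>

lemma primitive_of_S:
  obtains N C where "\<And>z. z \<in> ball p r \<Longrightarrow> (N has_field_derivative S z) (at z)"
    "\<And>z. z \<in> ball p \<delta> \<Longrightarrow> cnj (N (cnj (S z))) = z * S z - N z + C"
proof -
  have "simply_connected (ball p r)"
    by (simp add: convex_imp_simply_connected)
  then obtain N where N: "\<And>z. z \<in> ball p r \<Longrightarrow> (N has_field_derivative S z) (at z)"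
    using simply_connected_eq_global_primitive[OF open_ball, of p r] S_holo by blast
  have "((\<lambda>z. cnj (N (cnj (S z))) - (z * S z - N z)) has_field_derivative 0) (at z)" if z: "z \<in> ball p \<delta>" for z
  proof -
    have S': "(S has_field_derivative deriv S z) (at z)"
      using holomorphic_derivI[OF S_holo open_ball ball_r[OF z]] .
    have "((cnj \<circ> N \<circ> cnj) has_field_derivative cnj (S (cnj (S z)))) (at (S z))"
      by (rule has_field_derivative_cnj_cnj[OF N[OF S_in(2)[OF z]]])
    from DERIV_chain2[OF this S']
    have "((\<lambda>z. cnj (N (cnj (S z)))) has_field_derivative z * deriv S z) (at z)"
      by (simp add: o_def reflection_involution[OF z])
    from DERIV_diff[OF this DERIV_diff[OF DERIV_mult[OF DERIV_ident S'] N[OF ball_r[OF z]]]]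
    show ?thesis by (simp add: algebra_simps)
  qed
  then have "(\<lambda>z. cnj (N (cnj (S z))) - (z * S z - N z)) constant_on ball p \<delta>"
    by (rule has_field_derivative_0_imp_constant_on) auto
  then obtain C where "\<And>z. z \<in> ball p \<delta> \<Longrightarrow> cnj (N (cnj (S z))) - (z * S z - N z) = C"
    unfolding constant_on_def by blast
  then have "\<And>z. z \<in> ball p \<delta> \<Longrightarrow> cnj (N (cnj (S z))) = z * S z - N z + C"
    by (metis add.commute diff_add_cancel)
  with N show thesis by (rule that)
qed

lemma S_holo_subset:
  assumes "U \<subseteq> ball p \<delta>"
  shows "S holomorphic_on U"
  by (rule holomorphic_on_subset[OF S_holo]) (use assms ball_r in auto)

end

section \<open>Reflection across the curve\<close>

text \<open>The symmetry \<open>St w = cnj (S (cnj w))\<close> holds at the conjugates of the points of the curve, hence near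
  \<open>cnj p\<close> by the identity theorem.\<close>

lemma schwarz_germ_exists:
  fixes f :: "complex \<Rightarrow> real"
  assumes \<Omega>: "open \<Omega>" "p \<in> \<Omega>" and diff: "\<And>z. z \<in> \<Omega> \<Longrightarrow> f differentiable (at z)"
    and grad: "dx f p \<noteq> 0 \<or> dy f p \<noteq> 0" and fp: "f p = 0"
    and S: "schwarz_function_at f p S" and St: "schwarz_inverse_at p S St"
  obtains r \<delta> where "schwarz_germ S St p r \<delta>" "ball p \<delta> \<subseteq> \<Omega>"
    "\<And>z. z \<in> ball p \<delta> \<Longrightarrow> f z = 0 \<Longrightarrow> S z = cnj z"
proof -
  obtain r1 where r1: "r1 > 0" "S holomorphic_on ball p r1" "\<And>z. z \<in> ball p r1 \<Longrightarrow> f z = 0 \<Longrightarrow> S z = cnj z"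
    using S unfolding schwarz_function_at_def by blast
  obtain r2 where r2: "r2 > 0" "St holomorphic_on ball (cnj p) r2"
      "\<And>z. z \<in> ball p r2 \<Longrightarrow> St (S z) = z" "\<And>w. w \<in> ball (cnj p) r2 \<Longrightarrow> S (St w) = w"
    using St unfolding schwarz_inverse_at_def by blast
  obtain r3 where r3: "r3 > 0" "ball p r3 \<subseteq> \<Omega>"
    using \<Omega> openE by blast
  define r where "r = min r1 (min r2 r3)"
  have "r > 0" using r1 r2 r3 by (simp add: r_def)
  have sub: "ball p r \<subseteq> ball p r1" "ball p r \<subseteq> ball p r2" "ball p r \<subseteq> \<Omega>" "ball (cnj p) r \<subseteq> ball (cnj p) r2"
    using r3(2) by (auto simp: r_def)
  have S_holo: "S holomorphic_on ball p r" and St_holo: "St holomorphic_on ball (cnj p) r"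
    using r1(2) r2(2) sub by (auto intro: holomorphic_on_subset)
  have cnj_in: "cnj w \<in> ball p e \<longleftrightarrow> w \<in> ball (cnj p) e" for w e
    using cnj_ball[of w "cnj p" e] by simp
  have "p islimpt {z\<in>ball p r. f z = 0}"
    by (rule islimpt_zero_set) (use \<open>r > 0\<close> diff sub grad fp in auto)
  moreover have "(cnj \<circ> St \<circ> cnj) holomorphic_on ball p r"
  proof (rule holomorphic_on_compose_cnj_cnj)
    have "cnj ` ball p r \<subseteq> ball (cnj p) r"
      using cnj_in[of "cnj z" for z] by auto
    then show "St holomorphic_on cnj ` ball p r"
      by (rule holomorphic_on_subset[OF St_holo])
  qed auto
  then have "(\<lambda>z. cnj (St (cnj z)) - S z) holomorphic_on ball p r"
    using S_holo by (intro holomorphic_intros) (simp_all add: o_def)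
  moreover have "cnj (St (cnj z)) - S z = 0" if "z \<in> {z\<in>ball p r. f z = 0}" for z
    using r1(3)[of z] r2(3)[of z] that sub by (auto simp: subset_iff)
  ultimately have "cnj (St (cnj z)) - S z = 0" if "z \<in> ball p r" for z
    using analytic_continuation[of "\<lambda>z. cnj (St (cnj z)) - S z" "ball p r" "{z\<in>ball p r. f z = 0}" p z,
      OF _ open_ball connected_ball] that \<open>r > 0\<close> by fastforce
  then have St_eq: "St w = cnj (S (cnj w))" if "w \<in> ball (cnj p) r" for w
    using cnj_in[of w r] that by (metis complex_cnj_cnj eq_iff_diff_eq_0)
  have "isCont S p"
    using holomorphic_on_imp_continuous_on[OF S_holo] \<open>r > 0\<close> by (simp add: continuous_on_eq_continuous_at)
  moreover have "S p = cnj p" using r1 fp by simp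
  ultimately obtain e where e: "e > 0" "\<And>z. dist z p < e \<Longrightarrow> dist (S z) (cnj p) < r / 4"
    unfolding continuous_at_eps_delta using \<open>r > 0\<close> by (metis divide_pos_pos zero_less_numeral)
  define \<delta> where "\<delta> = min e (r / 4)"
  have \<delta>: "0 < \<delta>" "\<delta> \<le> r / 4" "\<delta> \<le> e" using e \<open>r > 0\<close> by (auto simp: \<delta>_def)
  have "schwarz_germ S St p r \<delta>"
  proof
    show "S z \<in> ball (cnj p) (r / 4)" if "z \<in> ball p \<delta>" for z
      using e(2)[of z] that \<delta> by (simp add: dist_commute)
    show "St (S z) = z" if "z \<in> ball p r" for z by (rule r2(3)[OF subsetD[OF sub(2) that]])
    show "S (St w) = w" if "w \<in> ball (cnj p) r" for w by (rule r2(4)[OF subsetD[OF sub(4) that]])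
  qed (fact \<delta> S_holo St_holo St_eq)+
  moreover have "ball p \<delta> \<subseteq> ball p r" using \<delta> by auto
  ultimately show thesis
    using that r1(3) sub by blast
qed

text \<open>Each formula is one of \<open>cauchy_reflection\<close>, \<open>dirichlet_reflection\<close> and \<open>neumann_reflection\<close>, with \<open>a\<close>
  taken from the corresponding \<open>V_fun_coeff\<close> lemma. The term \<open>Im a Im A'\<close> vanishes on the curve because
  \<open>a\<close> is real there if \<open>\<Delta>u = 0\<close>, and because the normalized \<open>A'\<close> is real there if \<open>\<partial>\<^sub>n \<Delta>u = 0\<close>.\<close>

lemma (in schwarz_germ) reflection_formulas:
  fixes f :: "complex \<Rightarrow> real"
  assumes diff: "\<And>z. z \<in> ball p \<delta> \<Longrightarrow> f differentiable (at z)"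
    and grad: "\<And>z. z \<in> ball p \<delta> \<Longrightarrow> f z = 0 \<Longrightarrow> dx f z \<noteq> 0 \<or> dy f z \<noteq> 0"
    and S_zero: "\<And>z. z \<in> ball p \<delta> \<Longrightarrow> f z = 0 \<Longrightarrow> S z = cnj z"
    and dom: "small_divided_domain f S p \<delta> U \<Gamma> U1 U2" and bih: "biharmonic_on u U"
    and P: "P \<in> U1" and Q: "Q = cnj (S P)" "Q \<in> U2"
  shows "(\<forall>q\<in>\<Gamma>. u q = 0 \<and> normal_deriv f u q = 0) \<Longrightarrow>
      u P = - u Q - Re (P - Q) * dx u Q - Im (P - Q) * dy u Q - (cmod (P - Q))\<^sup>2 / 4 * laplacian u Q"
    and "(\<forall>q\<in>\<Gamma>. u q = 0 \<and> laplacian u q = 0) \<Longrightarrow> joins_in U \<Gamma> Q \<gamma> \<Longrightarrow>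
      complex_of_real (u P) = - of_real (u Q) + K_term (V_fun coeff2 S St P) (\<lambda>q. of_real (u q)) \<gamma>"
    and "(\<forall>q\<in>\<Gamma>. u q = 0 \<and> normal_deriv f (laplacian u) q = 0) \<Longrightarrow> joins_in U \<Gamma> Q \<gamma> \<Longrightarrow>
      complex_of_real (u P) = - of_real (u Q) + K_term (V_fun coeff3 S St P) (\<lambda>q. of_real (u q)) \<gamma>"
    and "(\<forall>q\<in>\<Gamma>. normal_deriv f u q = 0 \<and> laplacian u q = 0) \<Longrightarrow> joins_in U \<Gamma> Q \<gamma> \<Longrightarrow>
      complex_of_real (u P) = of_real (u Q) + K_term (V_fun coeff4 S St P) (\<lambda>q. of_real (u q)) \<gamma>"
    and "(\<forall>q\<in>\<Gamma>. normal_deriv f u q = 0 \<and> normal_deriv f (laplacian u) q = 0) \<Longrightarrow> joins_in U \<Gamma> Q \<gamma> \<Longrightarrow>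
      complex_of_real (u P) = of_real (u Q) + K_term (V_fun coeff5 S St P) (\<lambda>q. of_real (u q)) \<gamma>"
proof -
  have U: "open U" "connected U" "simply_connected U" "U \<subseteq> ball p \<delta>"
    and \<Gamma>: "\<Gamma> = {z\<in>U. f z = 0}" and comps: "components (U - \<Gamma>) = {U1, U2}" "U1 \<noteq> U2"
    and conn: "connected (U \<inter> reflection S ` U)"
    using dom by (auto simp: small_divided_domain_def)
  have PQ: "P \<in> U" "cnj (S P) = Q" "Q \<in> U" "cnj (S Q) = P"
  proof -
    show "P \<in> U" "Q \<in> U"
      using in_components_subset[of U1 "U - \<Gamma>"] in_components_subset[of U2 "U - \<Gamma>"] comps P Q by auto
    then show "cnj (S P) = Q" "cnj (S Q) = P"
      using reflection_involution[of P] U(4) Q by (auto simp: reflection_def)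
  qed
  have refl: "U \<inter> reflection S ` U = {z\<in>U. cnj (S z) \<in> U}"
  proof (intro set_eqI iffI)
    fix z assume "z \<in> U \<inter> reflection S ` U"
    then obtain y where "z \<in> U" "y \<in> U" "z = cnj (S y)" by (auto simp: reflection_def)
    then show "z \<in> {z\<in>U. cnj (S z) \<in> U}"
      using reflection_involution[of y] U(4) by auto
  next
    fix z assume "z \<in> {z\<in>U. cnj (S z) \<in> U}"
    then show "z \<in> U \<inter> reflection S ` U"
      using reflection_involution[of z] U(4) by (auto simp: reflection_def image_iff intro!: bexI[of _ "cnj (S z)"])
  qed
  interpret reflected_domain S U \<Gamma>
  proof
    show "open U" "simply_connected U" "\<Gamma> \<subseteq> U" using U \<Gamma> by auto
    show "S holomorphic_on U" by (rule S_holo_subset[OF U(4)])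
    show "connected {z\<in>U. cnj (S z) \<in> U}" using conn by (simp add: refl)
    show "S z = cnj z" if "z \<in> \<Gamma>" for z
      using S_zero that \<Gamma> U(4) by auto
    show "z islimpt \<Gamma>" if "z \<in> \<Gamma>" for z
      unfolding \<Gamma> by (rule islimpt_zero_set) (use that \<Gamma> U diff grad in auto)
    show "\<Gamma> \<noteq> {}"
    proof
      assume "\<Gamma> = {}"
      moreover have "U \<noteq> {}" using PQ by auto
      ultimately have "{U1, U2} = {U}"
        using comps(1) components_eq_sing_iff[of U] U(2) by auto
      then show False using comps(2) by auto
    qed
  qed
  have grad_\<Gamma>: "dx f q \<noteq> 0 \<or> dy f q \<noteq> 0" "q \<in> ball p \<delta>" "f q = 0" "q \<in> U" if "q \<in> \<Gamma>" for q
    using that \<Gamma> U(4) grad by auto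
  have neumann: "of_real (dx g q) - \<i> * of_real (dy g q) = deriv S q * (of_real (dx g q) + \<i> * of_real (dy g q))"
    if "normal_deriv f g q = 0" "q \<in> \<Gamma>" for g q
  proof (rule normal_deriv_zero_imp[OF _ grad_\<Gamma>(1)[OF that(2)] that(1)])
    show "deriv S q * Complex (dx f q) (dy f q) = - cnj (Complex (dx f q) (dy f q))"
      by (rule schwarz_deriv_gradient[OF diff[OF grad_\<Gamma>(2)[OF that(2)]] holomorphic_derivI[OF S_holo open_U grad_\<Gamma>(4)[OF that(2)]]
            G_limpt[OF that(2)]]) (use that grad_\<Gamma> S_G in auto)
  qed
  obtain A B where AB: "A holomorphic_on U" "B holomorphic_on U"
    and u: "\<And>z. z \<in> U \<Longrightarrow> u z = 2 * Re (cnj z * A z + B z)"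
    using goursat_representation[OF U(1,3) bih] by blast

  have ball: "z \<in> ball p \<delta>" if "z \<in> U" for z using U(4) that by blast
  have cnj_PQ: "S P = cnj Q" "S Q = cnj P"
    using PQ by (metis complex_cnj_cnj)+

  show "u P = - u Q - Re (P - Q) * dx u Q - Im (P - Q) * dy u Q - (cmod (P - Q))\<^sup>2 / 4 * laplacian u Q"
    if bc: "\<forall>q\<in>\<Gamma>. u q = 0 \<and> normal_deriv f u q = 0"
    by (rule cauchy_reflection[OF AB u PQ]) (use bc neumann in auto)

  show "complex_of_real (u P) = - of_real (u Q) + K_term (V_fun coeff2 S St P) (\<lambda>q. of_real (u q)) \<gamma>"
    if bc: "\<forall>q\<in>\<Gamma>. u q = 0 \<and> laplacian u q = 0" and \<gamma>: "joins_in U \<Gamma> Q \<gamma>"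
  proof (rule dirichlet_reflection[OF AB u PQ _ _ V_fun_coeff2[OF ball[OF PQ(1)] Q(1) ball]])
    show "cnj (deriv A (cnj (S z))) = - 1 * deriv A z" if "z \<in> W" for z
      using laplacian_zero_on_W[OF AB u _ that] bc by simp
    show "(\<lambda>z. cnj (P - Q) * z + (P - Q) * S z) holomorphic_on U"
      by (intro holomorphic_intros S_holo)
    show "Im (cnj (P - Q) * Q + (P - Q) * S Q) = 0"
      unfolding cnj_PQ by (simp add: algebra_simps)
    show "Im (cnj (P - Q) * q + (P - Q) * S q) * Im (deriv A q) = 0" if "q \<in> \<Gamma>" for q
      unfolding S_G[OF that] by (simp add: algebra_simps)
    show "deriv (\<lambda>z. cnj (P - Q) * z + (P - Q) * S z) z = cnj (P - Q) - - 1 * (P - Q) * deriv S z"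
      if "z \<in> W" for z
      by (rule DERIV_imp_deriv) (auto intro!: derivative_eq_intros S_deriv[OF that] simp: algebra_simps)
  qed (use bc \<gamma> in auto)

  show "complex_of_real (u P) = - of_real (u Q) + K_term (V_fun coeff3 S St P) (\<lambda>q. of_real (u q)) \<gamma>"
    if bc: "\<forall>q\<in>\<Gamma>. u q = 0 \<and> normal_deriv f (laplacian u) q = 0" and \<gamma>: "joins_in U \<Gamma> Q \<gamma>"
  proof -
    obtain A1 where A1: "A1 holomorphic_on U" "\<And>z. z \<in> U \<Longrightarrow> u z = 2 * Re (cnj z * A1 z + B z)"
      "\<And>z. z \<in> W \<Longrightarrow> cnj (deriv A1 (cnj (S z))) = deriv A1 z"
      using normalized_goursat[OF AB u neumann] bc by blast
    show ?thesis
    proof (rule dirichlet_reflection[OF A1(1) AB(2) A1(2) PQ _ _ V_fun_coeff3[OF ball[OF PQ(1)] Q(1) ball]])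
      show "cnj (deriv A1 (cnj (S z))) = 1 * deriv A1 z" if "z \<in> W" for z
        using A1(3)[OF that] by simp
      show "(\<lambda>z. cnj (P - Q) * z - (P - Q) * S z + 2 * P * cnj Q) holomorphic_on U"
        by (intro holomorphic_intros S_holo)
      show "Im (cnj (P - Q) * Q - (P - Q) * S Q + 2 * P * cnj Q) = 0"
        unfolding cnj_PQ by (simp add: algebra_simps)
      show "Im (cnj (P - Q) * q - (P - Q) * S q + 2 * P * cnj Q) * Im (deriv A1 q) = 0" if "q \<in> \<Gamma>" for q
        using A1(3)[OF subsetD[OF G_sub_W that]] unfolding S_G[OF that] by (simp add: complex_eq_iff)
      show "deriv (\<lambda>z. cnj (P - Q) * z - (P - Q) * S z + 2 * P * cnj Q) z = cnj (P - Q) - 1 * (P - Q) * deriv S z"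
        if "z \<in> W" for z
        by (rule DERIV_imp_deriv) (auto intro!: derivative_eq_intros S_deriv[OF that] simp: algebra_simps)
    qed (use bc \<gamma> in auto)
  qed

  show "complex_of_real (u P) = of_real (u Q) + K_term (V_fun coeff4 S St P) (\<lambda>q. of_real (u q)) \<gamma>"
    if bc: "\<forall>q\<in>\<Gamma>. normal_deriv f u q = 0 \<and> laplacian u q = 0" and \<gamma>: "joins_in U \<Gamma> Q \<gamma>"
  proof (rule neumann_reflection[OF AB u PQ _ _ V_fun_coeff4[OF ball[OF PQ(1)] Q(1) ball]])
    show "cnj (deriv A (cnj (S z))) = - 1 * deriv A z" if "z \<in> W" for z
      using laplacian_zero_on_W[OF AB u _ that] bc by simp
    show "(\<lambda>z. cnj (P + Q) * z + (P + Q) * S z - 2 * z * S z) holomorphic_on U"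
      by (intro holomorphic_intros S_holo)
    show "Im (cnj (P + Q) * Q + (P + Q) * S Q - 2 * Q * S Q) = 0"
      unfolding cnj_PQ by (simp add: algebra_simps)
    show "Im (cnj (P + Q) * q + (P + Q) * S q - 2 * q * S q) * Im (deriv A q) = 0" if "q \<in> \<Gamma>" for q
      unfolding S_G[OF that] by (simp add: algebra_simps)
    show "deriv (\<lambda>z. cnj (P + Q) * z + (P + Q) * S z - 2 * z * S z) z =
        2 * - 1 * z * deriv S z - 2 * S z - - 1 * (P + Q) * deriv S z + cnj (P + Q)"
      if "z \<in> W" for z
      by (rule DERIV_imp_deriv) (auto intro!: derivative_eq_intros S_deriv[OF that] simp: algebra_simps)
    show "of_real (dx u q) - \<i> * of_real (dy u q) = deriv S q * (of_real (dx u q) + \<i> * of_real (dy u q))"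
      if "q \<in> \<Gamma>" for q using neumann[of u q] bc that by blast
  qed (use \<gamma> in auto)

  show "complex_of_real (u P) = of_real (u Q) + K_term (V_fun coeff5 S St P) (\<lambda>q. of_real (u q)) \<gamma>"
    if bc: "\<forall>q\<in>\<Gamma>. normal_deriv f u q = 0 \<and> normal_deriv f (laplacian u) q = 0" and \<gamma>: "joins_in U \<Gamma> Q \<gamma>"
  proof -
    obtain A1 where A1: "A1 holomorphic_on U" "\<And>z. z \<in> U \<Longrightarrow> u z = 2 * Re (cnj z * A1 z + B z)"
      "\<And>z. z \<in> W \<Longrightarrow> cnj (deriv A1 (cnj (S z))) = deriv A1 z"
      using normalized_goursat[OF AB u neumann] bc by blast
    obtain N C where N: "\<And>z. z \<in> ball p r \<Longrightarrow> (N has_field_derivative S z) (at z)"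
      and C: "\<And>z. z \<in> ball p \<delta> \<Longrightarrow> cnj (N (cnj (S z))) = z * S z - N z + C"
      using primitive_of_S by blast
    have N_U: "(N has_field_derivative S z) (at z)" if "z \<in> U" for z
      by (rule N[OF ball_r[OF ball[OF that]]])
    then have holN: "N holomorphic_on U"
      using open_U holomorphic_on_open by blast
    let ?k = "2 * cnj P * Q + 4 * C - 4 * cnj (N P)"
    let ?a = "\<lambda>z. 2 * z * S z - (P + Q) * S z + cnj (P + Q) * z - 4 * N z + ?k"
    show ?thesis
    proof (rule neumann_reflection[OF A1(1) AB(2) A1(2) PQ _ _ V_fun_coeff5[OF ball[OF PQ(1)] Q(1) ball N C]])
      show "cnj (deriv A1 (cnj (S z))) = 1 * deriv A1 z" if "z \<in> W" for z
        using A1(3)[OF that] by simp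
      show "?a holomorphic_on U"
        by (intro holomorphic_intros S_holo holN)
      have "4 * cnj (N P) = 4 * (Q * cnj P - N Q + C)"
        using C[OF ball[OF PQ(3)]] by (simp add: cnj_PQ)
      then show "Im (?a Q) = 0"
        unfolding cnj_PQ by (simp add: algebra_simps)
      show "Im (?a q) * Im (deriv A1 q) = 0" if "q \<in> \<Gamma>" for q
        using A1(3)[OF subsetD[OF G_sub_W that]] unfolding S_G[OF that] by (simp add: complex_eq_iff)
      show "deriv ?a z = 2 * 1 * z * deriv S z - 2 * S z - 1 * (P + Q) * deriv S z + cnj (P + Q)"
        if "z \<in> W" for z
        by (rule DERIV_imp_deriv)
           (auto intro!: derivative_eq_intros S_deriv[OF that] N_U[OF subsetD[OF W_sub that]] simp: algebra_simps)
      show "of_real (dx u q) - \<i> * of_real (dy u q) = deriv S q * (of_real (dx u q) + \<i> * of_real (dy u q))"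
        if "q \<in> \<Gamma>" for q using neumann[of u q] bc that by blast
    qed (use \<gamma> in auto)
  qed
qed

theorem theorem3p2:
  fixes f :: "complex \<Rightarrow> real" and S St :: "complex \<Rightarrow> complex"
    and \<Omega> :: "complex set" and p :: complex
  assumes "open \<Omega>" and "real_analytic_on f \<Omega>"
    and "\<forall>z\<in>\<Omega>. f z = 0 \<longrightarrow> dx f z \<noteq> 0 \<or> dy f z \<noteq> 0"
    and "p \<in> \<Omega>" and "f p = 0"
    and "schwarz_function_at f p S" and "schwarz_inverse_at p S St"
  shows "\<exists>\<delta>>0. ball p \<delta> \<subseteq> \<Omega> \<and>
    (\<forall>U \<Gamma> U1 U2 u x0 y0 P Q.
      small_divided_domain f S p \<delta> U \<Gamma> U1 U2 \<and> biharmonic_on u U \<and>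
      P = Complex x0 y0 \<and> P \<in> U1 \<and> Q = reflection S P \<and> Q \<in> U2 \<longrightarrow>
        ((\<forall>q\<in>\<Gamma>. u q = 0 \<and> normal_deriv f u q = 0) \<longrightarrow>
          complex_of_real (u P) = - complex_of_real (u Q)
            - (x0 - (S (x0 + \<i> * y0) + St (x0 - \<i> * y0)) / 2) * complex_of_real (dx u Q)
            - (y0 + (S (x0 + \<i> * y0) - St (x0 - \<i> * y0)) / (2 * \<i>)) * complex_of_real (dy u Q)
            - 1 / 4 * (x0\<^sup>2 + y0\<^sup>2 - S (x0 + \<i> * y0) * (x0 + \<i> * y0)
                       - St (x0 - \<i> * y0) * (x0 - \<i> * y0)
                       + S (x0 + \<i> * y0) * St (x0 - \<i> * y0)) * complex_of_real (laplacian u Q))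
      \<and> ((\<forall>q\<in>\<Gamma>. u q = 0 \<and> laplacian u q = 0) \<longrightarrow>
          (\<forall>\<gamma>. joins_in U \<Gamma> Q \<gamma> \<longrightarrow>
            complex_of_real (u P) = - complex_of_real (u Q) + K_term (V_fun coeff2 S St P) (\<lambda>q. complex_of_real (u q)) \<gamma>))
      \<and> ((\<forall>q\<in>\<Gamma>. u q = 0 \<and> normal_deriv f (laplacian u) q = 0) \<longrightarrow>
          (\<forall>\<gamma>. joins_in U \<Gamma> Q \<gamma> \<longrightarrow>
            complex_of_real (u P) = - complex_of_real (u Q) + K_term (V_fun coeff3 S St P) (\<lambda>q. complex_of_real (u q)) \<gamma>))
      \<and> ((\<forall>q\<in>\<Gamma>. normal_deriv f u q = 0 \<and> laplacian u q = 0) \<longrightarrow>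
          (\<forall>\<gamma>. joins_in U \<Gamma> Q \<gamma> \<longrightarrow>
            complex_of_real (u P) = complex_of_real (u Q) + K_term (V_fun coeff4 S St P) (\<lambda>q. complex_of_real (u q)) \<gamma>))
      \<and> ((\<forall>q\<in>\<Gamma>. normal_deriv f u q = 0 \<and> normal_deriv f (laplacian u) q = 0) \<longrightarrow>
          (\<forall>\<gamma>. joins_in U \<Gamma> Q \<gamma> \<longrightarrow>
            complex_of_real (u P) = complex_of_real (u Q) + K_term (V_fun coeff5 S St P) (\<lambda>q. complex_of_real (u q)) \<gamma>)))"
proof -
  have diff: "f differentiable (at z)" if "z \<in> \<Omega>" for z
    using real_analytic_on_differentiable[OF assms(2) that] .
  obtain r \<delta> where germ: "schwarz_germ S St p r \<delta>" and ball_\<Omega>: "ball p \<delta> \<subseteq> \<Omega>"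
    and S_zero: "\<And>z. z \<in> ball p \<delta> \<Longrightarrow> f z = 0 \<Longrightarrow> S z = cnj z"
    using schwarz_germ_exists[OF assms(1,4) diff _ assms(5-7)] assms(3-5) by blast
  interpret schwarz_germ S St p r \<delta> by (rule germ)
  have diff_ball: "f differentiable (at z)" if "z \<in> ball p \<delta>" for z
    using diff ball_\<Omega> that by blast
  have grad_ball: "dx f z \<noteq> 0 \<or> dy f z \<noteq> 0" if "z \<in> ball p \<delta>" "f z = 0" for z
    using assms(3) ball_\<Omega> that by blast
  have dom: "small_divided_domain f S p \<delta> U \<Gamma> U1 U2" "biharmonic_on u U" "P \<in> U1" "Q = cnj (S P)" "Q \<in> U2"
    if "small_divided_domain f S p \<delta> U \<Gamma> U1 U2 \<and> biharmonic_on u U \<and>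
      P = Complex x0 y0 \<and> P \<in> U1 \<and> Q = reflection S P \<and> Q \<in> U2"
    for U \<Gamma> U1 U2 P Q x0 y0 and u :: "complex \<Rightarrow> real"
    using that by (auto simp: reflection_def)
  show ?thesis
  proof (intro exI[of _ \<delta>] conjI allI impI)
    show "0 < \<delta>" "ball p \<delta> \<subseteq> \<Omega>" by (fact \<delta> ball_\<Omega>)+
    fix U \<Gamma> U1 U2 u x0 y0 P Q
    assume asm: "small_divided_domain f S p \<delta> U \<Gamma> U1 U2 \<and> biharmonic_on u U \<and>
      P = Complex x0 y0 \<and> P \<in> U1 \<and> Q = reflection S P \<and> Q \<in> U2"
      and bc: "\<forall>q\<in>\<Gamma>. u q = 0 \<and> normal_deriv f u q = 0"
    have P: "x0 + \<i> * y0 = P" "x0 - \<i> * y0 = cnj P" "x0 = Re P" "y0 = Im P"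
      using asm by (auto simp: complex_eq_iff)
    have "P \<in> ball p \<delta>"
      using dom(1,3)[OF asm] in_components_subset[of U1 "U - \<Gamma>"] unfolding small_divided_domain_def by blast
    then have S_P: "S P = cnj Q" "St (cnj P) = Q"
      using St_cnj dom(4)[OF asm] by simp_all
    have coeffs: "x0 - (cnj Q + Q) / 2 = complex_of_real (Re (P - Q))"
      "y0 + (cnj Q - Q) / (2 * \<i>) = complex_of_real (Im (P - Q))"
      unfolding P by (simp_all add: complex_eq_iff)
    have norm: "1 / 4 * ((complex_of_real x0)\<^sup>2 + (complex_of_real y0)\<^sup>2 - cnj Q * P - Q * cnj P + cnj Q * Q)
        = complex_of_real ((cmod (P - Q))\<^sup>2 / 4)"
      unfolding P cmod_power2 by (simp add: complex_eq_iff power2_eq_square field_simps)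
    have cauchy: "u P = - u Q - Re (P - Q) * dx u Q - Im (P - Q) * dy u Q - (cmod (P - Q))\<^sup>2 / 4 * laplacian u Q"
      by (rule reflection_formulas(1)[OF diff_ball grad_ball S_zero dom[OF asm] bc])
    show "complex_of_real (u P) = - complex_of_real (u Q)
            - (x0 - (S (x0 + \<i> * y0) + St (x0 - \<i> * y0)) / 2) * complex_of_real (dx u Q)
            - (y0 + (S (x0 + \<i> * y0) - St (x0 - \<i> * y0)) / (2 * \<i>)) * complex_of_real (dy u Q)
            - 1 / 4 * ((complex_of_real x0)\<^sup>2 + (complex_of_real y0)\<^sup>2 - S (x0 + \<i> * y0) * (x0 + \<i> * y0)
                       - St (x0 - \<i> * y0) * (x0 - \<i> * y0)
                       + S (x0 + \<i> * y0) * St (x0 - \<i> * y0)) * complex_of_real (laplacian u Q)"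
      unfolding P(1,2) S_P coeffs norm cauchy by simp
  qed (rule reflection_formulas(2-5)[OF diff_ball grad_ball S_zero dom]; assumption)+
qed

end
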